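(* Let $\mu^\star := \mathrm{sol}(\mu_\bot)$ be the inflationary fixpoint obtained by iterating $\mu \mapsto \mathrm{prg}_+(\mathrm{prg}_\bot(\mu))$ from the constant-$\bot$ measure function $\mu_\bot$. Then the winning region of player $0$ is $W_0 = \{ v \in V : \mu^\star(v)\!\restriction_v = \top \}$ and the winning region of player $1$ is $W_1 = \{ v \in V : \mu^\star(v)\!\restriction_v \neq \top \}$.
   Context: Let $G$ be a finite parity game with positions $V = V_0 \cup V_1$ (owned by player $0$ and player $1$ respectively), a left-total move relation $Mv$, and a priority function $\mathrm{pr}\colon V \to P$ with $P \subset \mathbb{N}$ finite. Player $0$ wins a play if the maximal priority occurring infinitely often is even, and player $1$ wins if it is odd. $W_0$ and $W_1$ denote the winning regions of the two players. Measures. A measure is either a distinguished top element $\top$ or a function $\eta\colon P \to \mathbb{N}$ whose highest priority with a nonzero value is even. The bottom element is $\bot := \mathbf{0}$, the all-zero function. Order. Measures are ordered by the alternate lexicographic order, and every non-$\top$ measure lies below $\top$. Concretely, $\eta_1 < \eta_2$ holds if, at the greatest index $k$ where $\eta_1$ and $\eta_2$ differ, either $k$ is even and $\eta_1(k) < \eta_2(k)$, or $k$ is odd and $\eta_1(k) > \eta_2(k)$. Truncation. $\top\!\restriction_v = \top$. For a non-$\top$ measure $\eta$, $\eta\!\restriction_v$ keeps the entries $\eta(k)$ with $k \ge \mathrm{pr}(v)$ and sets all other entries to $0$. Stretch. $\top + v = \top$. For a non-$\top$ measure $\eta$, $\eta + v := \max\{\bot, \eta + \delta_{\mathrm{pr}(v)}\}$,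 where $\delta_i$ is the function that is $1$ at $i$ and $0$ elsewhere. Differences of measures are taken pointwise in $P \to \mathbb{Z}$. Measure functions. A measure function $\mu$ maps each position to a measure. Measure functions are ordered pointwise. The denotations of $\mu$ are: - $[\![\mu]\!]_0 = \{v : \mu(v)\!\restriction_v = \top\}$; - $[\![\mu]\!]_1 = V \setminus [\![\mu]\!]_0$; - $[\![\mu]\!]_\bot = \{v : \mu(v)\!\restriction_v = \bot\}$; - $[\![\mu]\!]_+ = V \setminus [\![\mu]\!]_\bot$. Lift. The lift operator $\mathrm{lift}(\mu,S,T)$ changes only the positions in $S$: - for $v \in S \cap V_0$, $\mathrm{lift}(\mu,S,T)(v) = \max\{\mu(u)+v : u \in Mv(v)\cap T\}$; - for $v \in S \cap V_1$, $\mathrm{lift}(\mu,S,T)(v) = \min\{\mu(u)+v : u \in Mv(v)\cap T\}$; - for $v \notin S$, $\mathrm{lift}(\mu,S,T)(v) = \mu(v)$. Progress operator $\mathrm{prg}_\bot$. It is defined by $\mathrm{prg}_\bot(\mu) := \mathrm{lift}(\mu, [\![\mu]\!]_\bot, V)$. Escape set. For $Q \subseteq V$, $\mathrm{esc}(\mu,Q)$ is the union of two sets: - the positions $v \in Q \cap V_1$ with $Mv(v)\setminus Q \neq \emptyset$; - the positions $v \in Q\cap V_0$ such that $\mu(u)+v < \mu(v)$ for all $u \in Mv(v)\cap Q$. Best-escape forfeit $\mathrm{bef}(\mu,Q,v)$: - $\max\{(\mu(u)+v)-\mu(v) : u \in Mv(v)\setminus Q\}$ for $v \in \mathrm{esc}(\mu,Q)\cap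 V_0$; - the corresponding $\min$ for $v \in \mathrm{esc}(\mu,Q)\cap V_1$; - $\top$ otherwise. Best-escape positions. $\mathrm{bep}(\mu,Q) := \arg\min_{v\in Q} \mathrm{bef}(\mu,Q,v)$. Progress operator $\mathrm{prg}_+$. It computes $\mathrm{prg}_+(\mu)$ as follows: 1. Set $Q_0 := [\![\mu]\!]_+$ and $\mu_0 := \mu$. 2. Repeatedly set $E_i := \mathrm{bep}(\mu_i,Q_i)$, then $Q_{i+1} := Q_i \setminus E_i$, then $\mu_{i+1} := \mathrm{lift}(\mu_i, E_i, V\setminus Q_i)$. 3. Stop at the first $k$ with $E_k=\emptyset$. 4. Return $\mu_k$ modified so that every position of $Q_k$ is mapped to $\top$. Solver. $\mathrm{sol}(\mu)$ is the inflationary fixpoint, i.e. the limit of the ascending sequence obtained by repeatedly applying $\mathrm{prg}_+ \circ \mathrm{prg}_\bot$ starting from $\mu$. Starting from $\mu_\bot$, this sequence converges in finitely many steps. *)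

theory Defs
  imports Main "HOL-Library.Lattice_Constructions"
begin

hide_const (open) flat_complete_lattice.Value flat_complete_lattice.Top bot.Value

section \<open>Parity games\<close>

datatype player = Player0 | Player1

record 'v game =
  pos0 :: "'v set"
  pos1 :: "'v set"
  moves :: "('v \<times> 'v) set"
  prios :: "nat set"
  pr :: "'v \<Rightarrow> nat"

definition positions :: "'v game \<Rightarrow> 'v set" where
  "positions G = pos0 G \<union> pos1 G"

fun owned :: "'v game \<Rightarrow> player \<Rightarrow> 'v set" where
  "owned G Player0 = pos0 G"
| "owned G Player1 = pos1 G"

definition Mv :: "'v game \<Rightarrow> 'v \<Rightarrow> 'v set" where
  "Mv G v = {u. (v, u) \<in> moves G}"

definition parity_game :: "'v game \<Rightarrow> bool" where
  "parity_game G \<longleftrightarrow>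
     finite (positions G) \<and> pos0 G \<inter> pos1 G = {} \<and>
     moves G \<subseteq> positions G \<times> positions G \<and>
     (\<forall>v\<in>positions G. Mv G v \<noteq> {}) \<and>
     finite (prios G) \<and> pr G ` positions G \<subseteq> prios G"

definition is_play :: "'v game \<Rightarrow> (nat \<Rightarrow> 'v) \<Rightarrow> bool" where
  "is_play G \<pi> \<longleftrightarrow> (\<forall>n. \<pi> n \<in> positions G \<and> \<pi> (Suc n) \<in> Mv G (\<pi> n))"

definition max_inf_prio :: "'v game \<Rightarrow> (nat \<Rightarrow> 'v) \<Rightarrow> nat" where
  "max_inf_prio G \<pi> = Max {p \<in> prios G. infinite {n. pr G (\<pi> n) = p}}"

fun wins :: "'v game \<Rightarrow> player \<Rightarrow> (nat \<Rightarrow> 'v) \<Rightarrow> bool" where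
  "wins G Player0 \<pi> \<longleftrightarrow> even (max_inf_prio G \<pi>)"
| "wins G Player1 \<pi> \<longleftrightarrow> odd (max_inf_prio G \<pi>)"

text \<open>
  Strategies may depend on the whole history, a nonempty list of positions ending in the current one.
\<close>

definition strategy :: "'v game \<Rightarrow> player \<Rightarrow> ('v list \<Rightarrow> 'v) \<Rightarrow> bool" where
  "strategy G i \<sigma> \<longleftrightarrow> (\<forall>h. \<forall>v\<in>owned G i. \<sigma> (h @ [v]) \<in> Mv G v)"

definition consistent :: "'v game \<Rightarrow> player \<Rightarrow> ('v list \<Rightarrow> 'v) \<Rightarrow> (nat \<Rightarrow> 'v) \<Rightarrow> bool" where
  "consistent G i \<sigma> \<pi> \<longleftrightarrow>
     (\<forall>n. \<pi> n \<in> owned G i \<longrightarrow> \<pi> (Suc n) = \<sigma> (map \<pi> [0..<Suc n]))"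

definition winning_region :: "'v game \<Rightarrow> player \<Rightarrow> 'v set" where
  "winning_region G i =
     {v \<in> positions G. \<exists>\<sigma>. strategy G i \<sigma> \<and>
        (\<forall>\<pi>. is_play G \<pi> \<and> \<pi> 0 = v \<and> consistent G i \<sigma> \<pi> \<longrightarrow> wins G i \<pi>)}"


section \<open>The alternate lexicographic order\<close>

text \<open>
  Measures and their pointwise differences are both represented by finitely supported functions
  from priorities to integers, so that one linear order serves both. The measures proper are
  singled out by \<open>measure_set\<close> below; finite support makes the order total.
\<close>

typedef altlex = "{f :: nat \<Rightarrow> int. finite {k. f k \<noteq> 0}}"
  morphisms entry Altlex
  by (rule exI[of _ "\<lambda>_. 0"]) simp

setup_lifting type_definition_altlex

lemma finite_entry: "finite {k. entry f k \<noteq> 0}"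
  using entry[of f] by simp

lemma altlex_eqI: "(\<And>k. entry f k = entry g k) \<Longrightarrow> f = g"
  by (simp add: entry_inject[symmetric] fun_eq_iff)

lemma finite_support_Un:
  fixes f g h :: "nat \<Rightarrow> int"
  assumes "finite {k. f k \<noteq> 0}" "finite {k. g k \<noteq> 0}" "\<And>k. f k = 0 \<Longrightarrow> g k = 0 \<Longrightarrow> h k = 0"
  shows "finite {k. h k \<noteq> 0}"
  by (rule finite_subset[OF _ finite_UnI[OF assms(1,2)]]) (use assms(3) in auto)

instantiation altlex :: ab_group_add
begin

lift_definition zero_altlex :: altlex is "\<lambda>_. 0" by simp

lift_definition plus_altlex :: "altlex \<Rightarrow> altlex \<Rightarrow> altlex" is "\<lambda>f g k. f k + g k"
  by (erule (1) finite_support_Un) simp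

lift_definition uminus_altlex :: "altlex \<Rightarrow> altlex" is "\<lambda>f k. - f k" by simp

lift_definition minus_altlex :: "altlex \<Rightarrow> altlex \<Rightarrow> altlex" is "\<lambda>f g k. f k - g k"
  by (erule (1) finite_support_Un) simp

instance by standard (transfer; simp add: fun_eq_iff)+

end

lemma entry_simps [simp]:
  "entry 0 k = 0" "entry (f + g) k = entry f k + entry g k"
  "entry (- f) k = - entry f k" "entry (f - g) k = entry f k - entry g k"
  by (transfer; simp)+

instantiation altlex :: linordered_ab_group_add
begin

definition less_altlex :: "altlex \<Rightarrow> altlex \<Rightarrow> bool" where
  "f < g \<longleftrightarrow>
     (\<exists>k. (\<forall>j>k. entry f j = entry g j) \<and>
          (even k \<and> entry f k < entry g k \<or> odd k \<and> entry f k > entry g k))"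

definition less_eq_altlex :: "altlex \<Rightarrow> altlex \<Rightarrow> bool" where
  "f \<le> g \<longleftrightarrow> f < g \<or> f = (g :: altlex)"

instance
proof
  fix f g h :: altlex
  have irrefl: "\<not> f < f" for f :: altlex
    by (auto simp: less_altlex_def)
  have trans: "f < h" if "f < g" "g < h" for f g h :: altlex
  proof -
    from that obtain k l where
      k: "\<forall>j>k. entry f j = entry g j"
         "even k \<and> entry f k < entry g k \<or> odd k \<and> entry f k > entry g k" and
      l: "\<forall>j>l. entry g j = entry h j"
         "even l \<and> entry g l < entry h l \<or> odd l \<and> entry g l > entry h l"
      unfolding less_altlex_def by blast
    have above: "\<forall>j>max k l. entry f j = entry h j"
      using k(1) l(1) by simp
    consider "k < l" | "k = l" | "l < k"
      by linarith
    then have "even (max k l) \<and> entry f (max k l) < entry h (max k l) \<or>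
               odd (max k l) \<and> entry f (max k l) > entry h (max k l)"
    proof cases
      case 1
      then have "entry f l = entry g l" using k(1) by blast
      with 1 l(2) show ?thesis by (simp add: max_def)
    next
      case 2
      with k(2) l(2) show ?thesis by (metis max.idem order.strict_trans)
    next
      case 3
      then have "entry g k = entry h k" using l(1) by blast
      with 3 k(2) show ?thesis by (simp add: max_def)
    qed
    with above show ?thesis
      unfolding less_altlex_def by blast
  qed
  have total: "f < g \<or> f = g \<or> g < f" for f g :: altlex
  proof (cases "f = g")
    case False
    define D where "D = {k. entry f k \<noteq> entry g k}"
    have "finite D"
      by (rule finite_subset[OF _ finite_UnI[OF finite_entry[of f] finite_entry[of g]]])
        (auto simp: D_def)
    moreover have "D \<noteq> {}" using False altlex_eqI[of f g] by (auto simp: D_def)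
    ultimately obtain m where "m \<in> D" "\<forall>j>m. j \<notin> D"
      by (meson Max_ge Max_in leD)
    then have k: "entry f m \<noteq> entry g m" "\<forall>j>m. entry f j = entry g j"
      by (simp_all add: D_def)
    have k': "\<forall>j>m. entry g j = entry f j"
      using k(2) by simp
    consider "entry f m < entry g m" | "entry g m < entry f m"
      using k(1) by linarith
    then have "f < g \<or> g < f"
      using k(2) k' unfolding less_altlex_def by cases blast+
    then show ?thesis by blast
  qed simp
  show "f < g \<longleftrightarrow> f \<le> g \<and> \<not> g \<le> f"
    using irrefl trans unfolding less_eq_altlex_def by metis
  show "f \<le> f" by (simp add: less_eq_altlex_def)
  show "f \<le> g \<Longrightarrow> g \<le> h \<Longrightarrow> f \<le> h"
    using trans unfolding less_eq_altlex_def by blast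
  show "f \<le> g \<Longrightarrow> g \<le> f \<Longrightarrow> f = g"
    using irrefl trans unfolding less_eq_altlex_def by metis
  show "f \<le> g \<or> g \<le> f"
    using total unfolding less_eq_altlex_def by blast
  show "f \<le> g \<Longrightarrow> h + f \<le> h + g"
    by (auto simp: less_eq_altlex_def less_altlex_def)
qed

end

lift_definition delta :: "nat \<Rightarrow> altlex" is "\<lambda>i k. if k = i then 1 else 0"
  by simp

lift_definition keep_from :: "nat \<Rightarrow> altlex \<Rightarrow> altlex" is "\<lambda>p f k. if k \<ge> p then f k else 0"
  by (rule finite_subset[rotated]) auto

lemma entry_delta [simp]: "entry (delta i) k = (if k = i then 1 else 0)"
  by (simp add: delta.rep_eq)

lemma entry_keep_from [simp]: "entry (keep_from p f) k = (if k \<ge> p then entry f k else 0)"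
  by (simp add: keep_from.rep_eq)


section \<open>Measures\<close>

text \<open>Here \<open>Value 0\<close> is the bottom measure and \<open>Top\<close> the top measure.\<close>

type_synonym prog_measure = "altlex top"

definition measure_set :: "'v game \<Rightarrow> prog_measure set" where
  "measure_set G = insert Top (Value `
     {\<eta>. (\<forall>k. entry \<eta> k \<ge> 0) \<and> {k. entry \<eta> k \<noteq> 0} \<subseteq> prios G \<and>
         (\<eta> \<noteq> 0 \<longrightarrow> even (Max {k. entry \<eta> k \<noteq> 0}))})"

fun trunc :: "'v game \<Rightarrow> prog_measure \<Rightarrow> 'v \<Rightarrow> prog_measure" where
  "trunc G Top v = Top"
| "trunc G (Value \<eta>) v = Value (keep_from (pr G v) \<eta>)"

fun stretch :: "'v game \<Rightarrow> prog_measure \<Rightarrow> 'v \<Rightarrow> prog_measure" where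
  "stretch G Top v = Top"
| "stretch G (Value \<eta>) v = Value (max 0 (\<eta> + delta (pr G v)))"

text \<open>
  Differences are only ever needed for a subtrahend below \<open>Top\<close>; the value \<open>Top\<close> in the remaining
  cases with a \<open>Top\<close> subtrahend is a convention.
\<close>

fun difference :: "prog_measure \<Rightarrow> prog_measure \<Rightarrow> altlex top" where
  "difference (Value \<eta>) (Value \<theta>) = Value (\<eta> - \<theta>)"
| "difference _ _ = Top"

type_synonym 'v measure_fun = "'v \<Rightarrow> prog_measure"

definition mf_bot :: "'v measure_fun" where
  "mf_bot = (\<lambda>_. Value 0)"

definition den0 :: "'v game \<Rightarrow> 'v measure_fun \<Rightarrow> 'v set" where
  "den0 G \<mu> = {v \<in> positions G. trunc G (\<mu> v) v = Top}"

definition den1 :: "'v game \<Rightarrow> 'v measure_fun \<Rightarrow> 'v set" where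
  "den1 G \<mu> = positions G - den0 G \<mu>"

definition den_bot :: "'v game \<Rightarrow> 'v measure_fun \<Rightarrow> 'v set" where
  "den_bot G \<mu> = {v \<in> positions G. trunc G (\<mu> v) v = Value 0}"

definition den_plus :: "'v game \<Rightarrow> 'v measure_fun \<Rightarrow> 'v set" where
  "den_plus G \<mu> = positions G - den_bot G \<mu>"


section \<open>Progress operators and solver\<close>

text \<open>
  \<open>Max\<close> and \<open>Min\<close> are unspecified on the empty set. In the iteration started from \<open>mf_bot\<close> they are
  only applied to nonempty sets.
\<close>

definition lift :: "'v game \<Rightarrow> 'v measure_fun \<Rightarrow> 'v set \<Rightarrow> 'v set \<Rightarrow> 'v measure_fun" where
  "lift G \<mu> S T = (\<lambda>v.
     if v \<in> S \<inter> pos0 G then Max ((\<lambda>u. stretch G (\<mu> u) v) ` (Mv G v \<inter> T))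
     else if v \<in> S \<inter> pos1 G then Min ((\<lambda>u. stretch G (\<mu> u) v) ` (Mv G v \<inter> T))
     else \<mu> v)"

definition prg_bot :: "'v game \<Rightarrow> 'v measure_fun \<Rightarrow> 'v measure_fun" where
  "prg_bot G \<mu> = lift G \<mu> (den_bot G \<mu>) (positions G)"

definition esc :: "'v game \<Rightarrow> 'v measure_fun \<Rightarrow> 'v set \<Rightarrow> 'v set" where
  "esc G \<mu> Q =
     {v \<in> Q \<inter> pos1 G. Mv G v - Q \<noteq> {}} \<union>
     {v \<in> Q \<inter> pos0 G. \<forall>u \<in> Mv G v \<inter> Q. stretch G (\<mu> u) v < \<mu> v}"

definition bef :: "'v game \<Rightarrow> 'v measure_fun \<Rightarrow> 'v set \<Rightarrow> 'v \<Rightarrow> altlex top" where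
  "bef G \<mu> Q v =
     (if v \<in> esc G \<mu> Q \<inter> pos0 G
        then Max ((\<lambda>u. difference (stretch G (\<mu> u) v) (\<mu> v)) ` (Mv G v - Q))
      else if v \<in> esc G \<mu> Q \<inter> pos1 G
        then Min ((\<lambda>u. difference (stretch G (\<mu> u) v) (\<mu> v)) ` (Mv G v - Q))
      else Top)"

text \<open>
  A forfeit of \<open>Top\<close> means that there is no escape, so \<open>Top\<close> does not count as an attained minimum:
  \<open>bep G \<mu> Q\<close> is empty if no position of \<open>Q\<close> has a forfeit below \<open>Top\<close>. This is what makes the
  stopping criterion of \<open>prg_plus\<close> meaningful.
\<close>

definition bep :: "'v game \<Rightarrow> 'v measure_fun \<Rightarrow> 'v set \<Rightarrow> 'v set" where
  "bep G \<mu> Q = {v. is_arg_min (bef G \<mu> Q) (\<lambda>w. w \<in> Q) v \<and> bef G \<mu> Q v \<noteq> Top}"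

definition prg_plus_step ::
    "'v game \<Rightarrow> 'v set \<times> 'v measure_fun \<Rightarrow> 'v set \<times> 'v measure_fun" where
  "prg_plus_step G = (\<lambda>(Q, \<mu>).
     let E = bep G \<mu> Q in (Q - E, lift G \<mu> E (positions G - Q)))"

definition prg_plus_seq :: "'v game \<Rightarrow> 'v measure_fun \<Rightarrow> nat \<Rightarrow> 'v set \<times> 'v measure_fun" where
  "prg_plus_seq G \<mu> i = (prg_plus_step G ^^ i) (den_plus G \<mu>, \<mu>)"

definition prg_plus :: "'v game \<Rightarrow> 'v measure_fun \<Rightarrow> 'v measure_fun" where
  "prg_plus G \<mu> =
     (let k = (LEAST k. case prg_plus_seq G \<mu> k of (Q, \<nu>) \<Rightarrow> bep G \<nu> Q = {});
          (Q, \<nu>) = prg_plus_seq G \<mu> k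
      in (\<lambda>v. if v \<in> Q then Top else \<nu> v))"

text \<open>The limit of a sequence of iterates is the value at which it becomes stationary.\<close>

definition sol :: "'v game \<Rightarrow> 'v measure_fun \<Rightarrow> 'v measure_fun" where
  "sol G \<mu> = (THE \<nu>. \<exists>N. \<forall>n\<ge>N. ((prg_plus G \<circ> prg_bot G) ^^ n) \<mu> = \<nu>)"


section \<open>Closure properties of measures\<close>

text \<open>
  For functions with nonnegative entries, being at or above the zero function coincides with having
  an even highest nonzero priority. Hence measures are closed under \<open>stretch\<close> and \<open>trunc\<close>, although
  these are defined on the larger type.
\<close>

lemma zero_le_iff_even:
  assumes "\<forall>k. entry \<eta> k \<ge> 0"
  shows "0 \<le> \<eta> \<longleftrightarrow> (\<eta> \<noteq> 0 \<longrightarrow> even (Max {k. entry \<eta> k \<noteq> 0}))"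
proof (cases "\<eta> = 0")
  case False
  define D where "D = {k. entry \<eta> k \<noteq> 0}"
  define m where "m = Max D"
  have "finite D" by (simp add: D_def finite_entry)
  moreover have "D \<noteq> {}" using False altlex_eqI[of \<eta> 0] by (auto simp: D_def)
  ultimately have "m \<in> D" "\<forall>j\<in>D. j \<le> m" by (simp_all add: m_def)
  then have nz: "entry \<eta> m \<noteq> 0" and le: "\<And>j. entry \<eta> j \<noteq> 0 \<Longrightarrow> j \<le> m"
    by (simp_all add: D_def)
  have pos: "entry \<eta> m > 0" using nz assms[rule_format, of m] by linarith
  have above: "entry \<eta> j = 0" if "j > m" for j using le[of j] that by linarith
  have k: "k = m" if "\<forall>j>k. entry \<eta> j = 0" "entry \<eta> k \<noteq> 0" for k
    using that(1) nz le[OF that(2)] by (metis le_neq_implies_less)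
  have "0 < \<eta> \<longleftrightarrow> even m"
  proof
    assume "0 < \<eta>"
    then obtain k where k': "\<forall>j>k. entry \<eta> j = 0"
      "even k \<and> 0 < entry \<eta> k \<or> odd k \<and> 0 > entry \<eta> k"
      unfolding less_altlex_def by (metis entry_simps(1))
    then have "k = m" using k[of k] by auto
    then show "even m" using k'(2) assms by (metis leD)
  next
    assume "even m"
    then show "0 < \<eta>"
      unfolding less_altlex_def using pos above by (intro exI[of _ m]) simp
  qed
  then show ?thesis using False by (auto simp: less_eq_altlex_def m_def D_def)
qed simp

lemma measure_set_eq:
  "measure_set G = insert Top (Value `
     {\<eta>. 0 \<le> \<eta> \<and> (\<forall>k. entry \<eta> k \<ge> 0) \<and> {k. entry \<eta> k \<noteq> 0} \<subseteq> prios G})"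
proof -
  have "(\<forall>k. entry \<eta> k \<ge> 0) \<and> S \<and> (\<eta> \<noteq> 0 \<longrightarrow> even (Max {k. entry \<eta> k \<noteq> 0})) \<longleftrightarrow>
        0 \<le> \<eta> \<and> (\<forall>k. entry \<eta> k \<ge> 0) \<and> S" for \<eta> S
    using zero_le_iff_even[of \<eta>] by metis
  then show ?thesis
    unfolding measure_set_def by simp
qed

lemma mf_bot_in_measure_set: "mf_bot v \<in> measure_set G"
  by (auto simp: measure_set_eq mf_bot_def)

lemma stretch_in_measure_set:
  assumes "x \<in> measure_set G" "pr G v \<in> prios G"
  shows "stretch G x v \<in> measure_set G"
proof (cases x)
  case (Value \<eta>)
  with assms(1) have \<eta>: "\<forall>k. entry \<eta> k \<ge> 0" "{k. entry \<eta> k \<noteq> 0} \<subseteq> prios G"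
    by (auto simp: measure_set_eq)
  let ?\<theta> = "max 0 (\<eta> + delta (pr G v))"
  have "0 \<le> ?\<theta>" "\<forall>k. entry ?\<theta> k \<ge> 0" "{k. entry ?\<theta> k \<noteq> 0} \<subseteq> prios G"
    using \<eta> assms(2) by (auto simp: max_def split: if_splits)
  then show ?thesis
    unfolding Value stretch.simps measure_set_eq by blast
qed (simp add: measure_set_eq)

lemma trunc_in_measure_set:
  assumes "x \<in> measure_set G"
  shows "trunc G x v \<in> measure_set G"
proof (cases x)
  case (Value \<eta>)
  with assms have \<eta>: "\<forall>k. entry \<eta> k \<ge> 0" "{k. entry \<eta> k \<noteq> 0} \<subseteq> prios G" "0 \<le> \<eta>"
    by (auto simp: measure_set_eq)
  have "0 \<le> keep_from p \<eta>" for p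
  proof (cases "\<eta> = 0")
    case True
    then have "keep_from p \<eta> = 0" by (intro altlex_eqI) simp
    then show ?thesis by simp
  next
    case False
    with \<eta>(3) obtain k where k: "\<forall>j>k. 0 = entry \<eta> j"
      "even k \<and> 0 < entry \<eta> k \<or> odd k \<and> 0 > entry \<eta> k"
      unfolding less_eq_altlex_def less_altlex_def by auto
    show ?thesis
    proof (cases "k \<ge> p")
      case True
      with k show ?thesis
        unfolding less_eq_altlex_def less_altlex_def by (intro disjI1 exI[of _ k]) auto
    next
      case False
      with k have "keep_from p \<eta> = 0" by (intro altlex_eqI) auto
      then show ?thesis by simp
    qed
  qed
  moreover have "\<forall>k. entry (keep_from p \<eta>) k \<ge> 0" "{k. entry (keep_from p \<eta>) k \<noteq> 0} \<subseteq> prios G" for p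
    using \<eta>(1,2) by auto
  ultimately show ?thesis
    unfolding Value trunc.simps measure_set_eq by blast
qed (simp add: measure_set_eq)

end

theory Submission
  imports Defs "HOL-Library.Infinite_Set"
begin

text \<open>
  Give position \<open>v\<close> the weight \<open>delta (pr G v)\<close> in the ordered group \<open>altlex\<close>. The total weight of a
  cycle is positive iff its highest priority is even, so the parity game is an energy game over
  \<open>altlex\<close>, and \<open>stretch\<close> adds a weight and clips at zero. All iterates of the solver are regress
  functions: \<open>\<mu> v \<le> stretch G (\<mu> u) v\<close> for some move of player 0 and for all moves of player 1. When
  the escape loop gets stuck on \<open>Q\<close>, player 0 can therefore stay in \<open>Q\<close> along a regress, which forces
  every cycle to have positive weight, so all of \<open>Q\<close> may be sent to \<open>Top\<close>. Every position leaving the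
  loop earlier receives the weight of a simple path; hence only finitely many measures occur and the
  iteration becomes stationary. A fixpoint is also a progress function, and there player 1 can hold
  the play below \<open>Top\<close> with all cycles of nonpositive weight.
\<close>

section \<open>Winning plays and positional dominions\<close>

lemma entry_sum [simp]: "entry (sum f A) k = (\<Sum>i\<in>A. entry (f i) k)"
  by (induction A rule: infinite_finite_induct) auto

locale finite_parity_game =
  fixes G :: "'v game"
  assumes game: "parity_game G"
begin

lemma finite_positions: "finite (positions G)"
  and pos_disjoint: "pos0 G \<inter> pos1 G = {}"
  and moves_subset: "moves G \<subseteq> positions G \<times> positions G"
  and Mv_nonempty: "v \<in> positions G \<Longrightarrow> Mv G v \<noteq> {}"
  and finite_prios: "finite (prios G)"
  and pr_in_prios: "v \<in> positions G \<Longrightarrow> pr G v \<in> prios G"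
  using game by (auto simp: parity_game_def)

lemma Mv_subset: "Mv G v \<subseteq> positions G"
  using moves_subset by (auto simp: Mv_def)

lemma finite_Mv: "finite (Mv G v)"
  using Mv_subset finite_positions finite_subset by blast

lemma pos_cases:
  assumes "v \<in> positions G"
  obtains "v \<in> pos0 G" "v \<notin> pos1 G" | "v \<in> pos1 G" "v \<notin> pos0 G"
  using assms pos_disjoint by (auto simp: positions_def)

lemma owned_subset: "owned G i \<subseteq> positions G"
  by (cases i) (auto simp: positions_def)

section \<open>Prefix independence and the weight of a recurring cycle\<close>

lemma is_play_shift: "is_play G \<pi> \<Longrightarrow> is_play G (\<lambda>n. \<pi> (n + k))"
  by (simp add: is_play_def)

lemma infinite_shift: "infinite {n. P (n + k)} \<longleftrightarrow> infinite {n::nat. P n}"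
proof -
  have "\<exists>n\<ge>m. P (n + k)" if "\<And>m. \<exists>n\<ge>m. P n" for m
  proof -
    obtain n where "n \<ge> m + k" "P n" using \<open>\<And>m. \<exists>n\<ge>m. P n\<close> by blast
    then show ?thesis by (intro exI[of _ "n - k"]) auto
  qed
  moreover have "\<exists>n\<ge>m. P n" if "\<exists>n\<ge>m. P (n + k)" for m
    using that trans_le_add1 by blast
  ultimately show ?thesis
    unfolding infinite_nat_iff_unbounded_le by (simp; blast)
qed

lemma wins_shift: "wins G i (\<lambda>n. \<pi> (n + k)) \<longleftrightarrow> wins G i \<pi>"
  using infinite_shift[of "\<lambda>n. pr G (\<pi> n) = p" for p] by (cases i) (simp_all add: max_inf_prio_def)

text \<open>The \<open>Max\<close> in the winning condition is meaningful because its set is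
  nonempty: by pigeonhole over the finitely many priorities, some priority recurs forever.\<close>

lemma max_inf_prio:
  assumes "is_play G \<pi>"
  shows max_inf_prio_infinite: "infinite {n. pr G (\<pi> n) = max_inf_prio G \<pi>}"
    and max_inf_prio_ge: "infinite {n. pr G (\<pi> n) = p} \<Longrightarrow> p \<le> max_inf_prio G \<pi>"
proof -
  let ?P = "{p \<in> prios G. infinite {n. pr G (\<pi> n) = p}}"
  have *: "pr G (\<pi> n) \<in> prios G" for n
    using assms pr_in_prios by (auto simp: is_play_def)
  have "finite (range (\<lambda>n. pr G (\<pi> n)))"
    by (rule finite_subset[OF _ finite_prios]) (use * in auto)
  then obtain m where "infinite {n. pr G (\<pi> n) = pr G (\<pi> m)}"
    using pigeonhole_infinite[of UNIV "\<lambda>n. pr G (\<pi> n)"] by auto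
  then have "?P \<noteq> {}"
    using *[of m] by blast
  moreover have fin: "finite ?P" using finite_prios by simp
  ultimately have "Max ?P \<in> ?P" by (rule Max_in[rotated])
  then show "infinite {n. pr G (\<pi> n) = max_inf_prio G \<pi>}"
    by (simp add: max_inf_prio_def)
  assume p: "infinite {n. pr G (\<pi> n) = p}"
  then have "{n. pr G (\<pi> n) = p} \<noteq> {}" using finite.emptyI by metis
  then have "p \<in> ?P" using p * by auto
  then show "p \<le> max_inf_prio G \<pi>"
    using Max_ge[OF fin] by (simp add: max_inf_prio_def)
qed

text \<open>From some time \<open>N\<close> on, no priority above the maximal recurring one occurs,
  and some position of that priority recurs. Between two such visits the total weight has a positive
  entry there and zero entries above, so the alternate order turns the parity of this priority into
  the sign of the weight.\<close>

lemma play_cycle: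
  assumes "is_play G \<pi>"
  obtains a b where "a < b" "\<pi> a = \<pi> b"
    "if even (max_inf_prio G \<pi>) then 0 < (\<Sum>i\<in>{a..<b}. delta (pr G (\<pi> i)))
     else (\<Sum>i\<in>{a..<b}. delta (pr G (\<pi> i))) < 0"
proof -
  let ?p = "max_inf_prio G \<pi>"
  let ?H = "{n. \<exists>p\<in>prios G. p > ?p \<and> pr G (\<pi> n) = p}"
  have "?H = (\<Union>p\<in>{p\<in>prios G. p > ?p}. {n. pr G (\<pi> n) = p})" by auto
  moreover have "finite {n. pr G (\<pi> n) = p}" if "p > ?p" for p
    using max_inf_prio_ge[OF assms, of p] that by (meson leD)
  ultimately have "finite ?H" using finite_prios by simp
  then obtain N where N: "\<forall>n\<in>?H. n < N"
    unfolding finite_nat_set_iff_bounded by (rule exE)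
  have low: "pr G (\<pi> n) \<le> ?p" if "n \<ge> N" for n
    using bspec[OF N, of n] that pr_in_prios assms by (force simp: is_play_def)
  let ?I = "{n. pr G (\<pi> n) = ?p}"
  have "finite (\<pi> ` ?I)"
    using assms by (intro finite_subset[OF _ finite_positions]) (auto simp: is_play_def)
  then obtain m where v: "infinite {n \<in> ?I. \<pi> n = \<pi> m}"
    using pigeonhole_infinite[OF max_inf_prio_infinite[OF assms], of \<pi>] by auto
  obtain a where a: "a \<ge> N" "\<pi> a = \<pi> m" "pr G (\<pi> a) = ?p"
    using spec[OF v[unfolded infinite_nat_iff_unbounded_le], of N] by auto
  obtain b where b: "b > a" "\<pi> b = \<pi> m"
    using spec[OF v[unfolded infinite_nat_iff_unbounded], of a] by auto
  let ?s = "\<Sum>i\<in>{a..<b}. delta (pr G (\<pi> i))"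
  have "entry ?s ?p > 0"
  proof -
    have "entry ?s ?p \<ge> (\<Sum>i\<in>{a}. entry (delta (pr G (\<pi> i))) ?p)"
      unfolding entry_sum using b by (intro sum_mono2) auto
    then show ?thesis using a by simp
  qed
  moreover have "entry ?s j = 0" if "j > ?p" for j
  proof -
    have "pr G (\<pi> i) \<noteq> j" if "i \<in> {a..<b}" for i
      using low[of i] that a(1) \<open>j > ?p\<close> by simp
    then show ?thesis by (force intro!: sum.neutral simp: eq_commute[of j])
  qed
  ultimately have "if even ?p then 0 < ?s else ?s < 0"
    unfolding less_altlex_def by (auto intro!: exI[of _ ?p])
  with a b that show ?thesis by metis
qed

lemma telescope_le:
  fixes g w :: "nat \<Rightarrow> 'a :: linordered_ab_group_add"
  assumes "\<And>n. g n \<le> w n + g (Suc n)" "a \<le> b"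
  shows "g a \<le> (\<Sum>i\<in>{a..<b}. w i) + g b"
  using assms(2)
proof (induction b rule: dec_induct)
  case (step n)
  have "g a \<le> (\<Sum>i\<in>{a..<n}. w i) + g n" by fact
  also have "\<dots> \<le> (\<Sum>i\<in>{a..<n}. w i) + (w n + g (Suc n))"
    using assms(1) by (intro add_left_mono)
  finally show ?case using step by (simp add: add.assoc)
qed simp

text \<open>\<open>f\<close> is a potential: it cancels around the cycle given by
  \<open>play_cycle\<close>, so the cycle has nonnegative weight, which an odd maximum would
  contradict.\<close>

lemma wins_Player0:
  assumes "is_play G \<pi>" "\<And>n. f (\<pi> n) \<le> delta (pr G (\<pi> n)) + f (\<pi> (Suc n))"
  shows "wins G Player0 \<pi>"
proof -
  obtain a b where ab: "a < b" "\<pi> a = \<pi> b"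
    "if even (max_inf_prio G \<pi>) then 0 < (\<Sum>i\<in>{a..<b}. delta (pr G (\<pi> i)))
     else (\<Sum>i\<in>{a..<b}. delta (pr G (\<pi> i))) < 0"
    using play_cycle[OF assms(1)] .
  have "0 \<le> (\<Sum>i\<in>{a..<b}. delta (pr G (\<pi> i)))"
    using telescope_le[of "\<lambda>n. f (\<pi> n)" "\<lambda>n. delta (pr G (\<pi> n))" a b] assms(2) ab by simp
  then show ?thesis using ab(3) by (auto split: if_splits)
qed

lemma wins_Player1:
  assumes "is_play G \<pi>" "\<And>n. delta (pr G (\<pi> n)) + f (\<pi> (Suc n)) \<le> f (\<pi> n)"
  shows "wins G Player1 \<pi>"
proof -
  obtain a b where ab: "a < b" "\<pi> a = \<pi> b"
    "if even (max_inf_prio G \<pi>) then 0 < (\<Sum>i\<in>{a..<b}. delta (pr G (\<pi> i)))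
     else (\<Sum>i\<in>{a..<b}. delta (pr G (\<pi> i))) < 0"
    using play_cycle[OF assms(1)] .
  \<comment> \<open>Negating the potential and the weights reduces this case to the same telescoping
    bound.\<close>
  have "- f (\<pi> n) \<le> - delta (pr G (\<pi> n)) + - f (\<pi> (Suc n))" for n
    using neg_le_iff_le[THEN iffD2, OF assms(2)[of n]] by (simp add: algebra_simps)
  then have "(\<Sum>i\<in>{a..<b}. delta (pr G (\<pi> i))) \<le> 0"
    using telescope_le[of "\<lambda>n. - f (\<pi> n)" "\<lambda>n. - delta (pr G (\<pi> n))" a b] ab
    by (simp add: sum_negf)
  then show ?thesis using ab(3) by (auto split: if_splits)
qed

section \<open>Positional strategies, traps and dominions\<close>

definition follows :: "player \<Rightarrow> ('v \<Rightarrow> 'v) \<Rightarrow> (nat \<Rightarrow> 'v) \<Rightarrow> bool" where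
  "follows i \<tau> \<pi> \<longleftrightarrow> (\<forall>n. \<pi> n \<in> owned G i \<longrightarrow> \<pi> (Suc n) = \<tau> (\<pi> n))"

text \<open>Source \<open>E\<close> and target \<open>D\<close> are kept apart so that positions
  newly added to a dominion may also move into its older part.\<close>

definition traps :: "player \<Rightarrow> ('v \<Rightarrow> 'v) \<Rightarrow> 'v set \<Rightarrow> 'v set \<Rightarrow> bool" where
  "traps i \<tau> E D \<longleftrightarrow>
     (\<forall>v\<in>E. (v \<in> owned G i \<longrightarrow> \<tau> v \<in> Mv G v \<inter> D) \<and> (v \<notin> owned G i \<longrightarrow> Mv G v \<subseteq> D))"

text \<open>Only plays that never leave \<open>E\<close> are judged; plays that pass into an older
  dominion are settled in \<open>dominion_extend\<close>.\<close>

definition wins_within :: "player \<Rightarrow> ('v \<Rightarrow> 'v) \<Rightarrow> 'v set \<Rightarrow> bool" where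
  "wins_within i \<tau> E \<longleftrightarrow>
     (\<forall>\<pi>. is_play G \<pi> \<and> range \<pi> \<subseteq> E \<and> follows i \<tau> \<pi> \<longrightarrow> wins G i \<pi>)"

definition dominion :: "player \<Rightarrow> 'v set \<Rightarrow> bool" where
  "dominion i D \<longleftrightarrow> D \<subseteq> positions G \<and> (\<exists>\<tau>. traps i \<tau> D D \<and> wins_within i \<tau> D)"

lemma traps_play:
  assumes "traps i \<tau> D D" "is_play G \<pi>" "follows i \<tau> \<pi>" "\<pi> k \<in> D"
  shows "\<pi> (n + k) \<in> D"
proof (induction n)
  case (Suc n)
  have "\<pi> (Suc (n + k)) \<in> Mv G (\<pi> (n + k))" using assms(2) by (simp add: is_play_def)
  then show ?case
    using assms(1,3) Suc
    by (cases "\<pi> (n + k) \<in> owned G i") (force simp: traps_def follows_def)+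
qed (use assms in simp)

lemma follows_shift: "follows i \<tau> \<pi> \<Longrightarrow> follows i \<tau> (\<lambda>n. \<pi> (n + k))"
  by (simp add: follows_def)

text \<open>The glued strategy uses \<open>\<tau>\<close> on \<open>D\<close> and
  \<open>\<tau>'\<close> elsewhere. A play that ever enters \<open>D\<close> stays there and its
  tail is won, which suffices by prefix independence; any other play lies in
  \<open>D' - D\<close>.\<close>

lemma dominion_extend:
  assumes "dominion i D" "D \<subseteq> D'" "D' \<subseteq> positions G"
    and "traps i \<tau>' (D' - D) D'" "wins_within i \<tau>' (D' - D)"
  shows "dominion i D'"
proof -
  obtain \<tau> where \<tau>: "traps i \<tau> D D" "wins_within i \<tau> D"
    using assms(1) by (auto simp: dominion_def)
  define \<sigma> where "\<sigma> v = (if v \<in> D then \<tau> v else \<tau>' v)" for v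
  have "traps i \<sigma> D' D'"
    unfolding traps_def
  proof
    fix v assume v: "v \<in> D'"
    show "(v \<in> owned G i \<longrightarrow> \<sigma> v \<in> Mv G v \<inter> D') \<and> (v \<notin> owned G i \<longrightarrow> Mv G v \<subseteq> D')"
    proof (cases "v \<in> D")
      case True
      then show ?thesis using \<tau>(1) assms(2) by (auto simp: traps_def \<sigma>_def)
    next
      case False
      then show ?thesis using v assms(4) by (auto simp: traps_def \<sigma>_def)
    qed
  qed
  moreover have "wins G i \<pi>" if \<pi>: "is_play G \<pi>" "range \<pi> \<subseteq> D'" "follows i \<sigma> \<pi>" for \<pi>
  proof (cases "\<exists>k. \<pi> k \<in> D")
    case True
    then obtain k where k: "\<pi> k \<in> D" by blast
    let ?\<pi> = "\<lambda>n. \<pi> (n + k)"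
    have "traps i \<sigma> D D" using \<tau>(1) by (simp add: traps_def \<sigma>_def)
    then have in_D: "?\<pi> n \<in> D" for n
      using traps_play[OF _ \<pi>(1,3) k] by blast
    then have "follows i \<tau> ?\<pi>"
      using follows_shift[OF \<pi>(3), of k] by (simp add: follows_def \<sigma>_def)
    then have "wins G i ?\<pi>"
      using \<tau>(2) is_play_shift[OF \<pi>(1)] in_D unfolding wins_within_def by blast
    then show ?thesis by (simp add: wins_shift)
  next
    case False
    then have "follows i \<tau>' \<pi>" "range \<pi> \<subseteq> D' - D"
      using \<pi> by (auto simp: follows_def \<sigma>_def)
    then show ?thesis using assms(5) \<pi>(1) unfolding wins_within_def by blast
  qed
  ultimately show ?thesis
    using assms(3) unfolding dominion_def wins_within_def by blast
qed

lemma dominion_winning_region: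
  assumes "dominion i D"
  shows "D \<subseteq> winning_region G i"
proof
  fix v assume v: "v \<in> D"
  obtain \<tau> where \<tau>: "traps i \<tau> D D" "wins_within i \<tau> D" and D: "D \<subseteq> positions G"
    using assms by (auto simp: dominion_def)
  \<comment> \<open>\<open>strategy\<close> demands a legal move at every owned position, so outside
    \<open>D\<close> an arbitrary successor is chosen.\<close>
  define \<sigma>' where "\<sigma>' w = (if w \<in> D then \<tau> w else SOME u. u \<in> Mv G w)" for w
  define \<sigma> where "\<sigma> h = \<sigma>' (last h)" for h
  have "\<sigma>' w \<in> Mv G w" if "w \<in> owned G i" for w
    using that owned_subset[of i] Mv_nonempty[of w] \<tau>(1) some_in_eq[of "Mv G w"]
    by (auto simp: \<sigma>'_def traps_def)
  then have "strategy G i \<sigma>" by (simp add: strategy_def \<sigma>_def)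
  moreover have "wins G i \<pi>" if \<pi>: "is_play G \<pi>" "\<pi> 0 = v" "consistent G i \<sigma> \<pi>" for \<pi>
  proof -
    have *: "follows i \<sigma>' \<pi>"
      using \<pi>(3) by (simp add: consistent_def follows_def \<sigma>_def)
    have "traps i \<sigma>' D D" using \<tau>(1) by (simp add: traps_def \<sigma>'_def)
    then have in_D: "\<pi> n \<in> D" for n
      using traps_play[OF _ \<pi>(1) *, of D 0 n] v \<pi>(2) by simp
    then have "follows i \<tau> \<pi>" using * by (simp add: follows_def \<sigma>'_def)
    then show ?thesis using \<tau>(2) \<pi>(1) in_D unfolding wins_within_def by blast
  qed
  ultimately show "v \<in> winning_region G i"
    using v D unfolding winning_region_def by blast
qed

text \<open>Two winning strategies played against each other from a common position would produce
  one play won by both players, but its maximal recurring priority has only one parity.\<close>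

lemma winning_regions_disjoint: "winning_region G Player0 \<inter> winning_region G Player1 = {}"
proof (rule ccontr)
  assume "\<not> ?thesis"
  then obtain v \<sigma>0 \<sigma>1 where v: "v \<in> positions G"
    and s: "strategy G Player0 \<sigma>0" "strategy G Player1 \<sigma>1"
    and w0: "\<And>\<pi>. is_play G \<pi> \<Longrightarrow> \<pi> 0 = v \<Longrightarrow> consistent G Player0 \<sigma>0 \<pi> \<Longrightarrow> wins G Player0 \<pi>"
    and w1: "\<And>\<pi>. is_play G \<pi> \<Longrightarrow> \<pi> 0 = v \<Longrightarrow> consistent G Player1 \<sigma>1 \<pi> \<Longrightarrow> wins G Player1 \<pi>"
    unfolding winning_region_def by blast
  \<comment> \<open>Strategies read whole histories, so the play is built as a growing list;
    positions not in \<open>pos0 G\<close> are left to player 1.\<close>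
  define nxt where "nxt h = (if last h \<in> pos0 G then \<sigma>0 h else \<sigma>1 h)" for h
  define hist where "hist n = ((\<lambda>h. h @ [nxt h]) ^^ n) [v]" for n
  define \<pi> where "\<pi> n = last (hist n)" for n
  have hist: "hist n = map \<pi> [0..<Suc n]" for n
  proof (induction n)
    case (Suc n)
    have "hist (Suc n) = hist n @ [\<pi> (Suc n)]" by (simp add: hist_def \<pi>_def)
    then show ?case using Suc by simp
  qed (simp add: hist_def \<pi>_def)
  have step: "\<pi> (Suc n) = nxt (map \<pi> [0..<Suc n])" for n
    unfolding hist[symmetric] by (simp add: hist_def \<pi>_def)
  have init: "\<pi> 0 = v" by (simp add: hist_def \<pi>_def)
  have mv: "\<pi> (Suc n) \<in> Mv G (\<pi> n)" if "\<pi> n \<in> positions G" for n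
    using that by (rule pos_cases)
      (use s in \<open>auto simp: step nxt_def strategy_def\<close>)
  have pos: "\<pi> n \<in> positions G" for n
    by (induction n) (use init v mv Mv_subset in auto)
  have play: "is_play G \<pi>" using pos mv by (simp add: is_play_def)
  have "consistent G Player0 \<sigma>0 \<pi>"
    by (simp add: consistent_def step nxt_def)
  moreover have "consistent G Player1 \<sigma>1 \<pi>"
    using pos_disjoint by (auto simp: consistent_def step nxt_def)
  ultimately show False using w0[OF play init] w1[OF play init] by simp
qed

end

section \<open>Regress measure functions\<close>

lemma stretch_mono: "x \<le> y \<Longrightarrow> stretch G x v \<le> stretch G y v"
  by (cases x; cases y) (auto intro: max.coboundedI2)

lemma stretch_eq_Top_iff [simp]: "stretch G x v = Top \<longleftrightarrow> x = Top"
  by (cases x) auto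

lemma zero_le_stretch: "Value 0 \<le> stretch G x v"
  by (cases x) auto

lemma difference_mono: "mono (\<lambda>x. difference x (Value \<xi>))"
proof (rule monoI)
  show "difference x (Value \<xi>) \<le> difference y (Value \<xi>)" if "x \<le> y" for x y
    using that by (cases x; cases y) auto
qed

lemma difference_eq_ValueD: "difference x (Value \<xi>) = Value a \<Longrightarrow> x = Value (\<xi> + a)"
  by (cases x) auto

text \<open>Values that the solver assigns at \<open>v\<close> are zero, \<open>Top\<close>, or an
  unclipped stretch, which has a positive entry at the priority of \<open>v\<close>. This form lets
  truncation at \<open>v\<close> detect zero.\<close>

definition admissible :: "'v game \<Rightarrow> 'v \<Rightarrow> prog_measure \<Rightarrow> bool" where
  "admissible G v x \<longleftrightarrow>
     (\<forall>\<eta>. x = Value \<eta> \<longrightarrow> 0 \<le> \<eta> \<and> (\<forall>k. 0 \<le> entry \<eta> k) \<and> (\<eta> = 0 \<or> 0 < entry \<eta> (pr G v)))"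

lemma admissible_zero: "admissible G v (Value 0)"
  by (simp add: admissible_def)

lemma admissible_Top: "admissible G v Top"
  by (simp add: admissible_def)

lemma admissible_stretch: "admissible G u x \<Longrightarrow> admissible G v (stretch G x v)"
  by (cases x) (auto simp: admissible_def max_def add_nonneg_pos)

text \<open>Each stretch raises entries by at most one, so measures collected along \<open>n\<close>
  moves from a zero measure stay in this finite set.\<close>

definition entries_le :: "'v game \<Rightarrow> nat \<Rightarrow> prog_measure set" where
  "entries_le G n = insert Top (Value ` {\<eta>. \<forall>k. 0 \<le> entry \<eta> k \<and> entry \<eta> k \<le> int n \<and>
     (k \<notin> prios G \<longrightarrow> entry \<eta> k = 0)})"

lemma entries_le_zero: "Value 0 \<in> entries_le G n"
  by (auto simp: entries_le_def)

lemma entries_le_Top: "Top \<in> entries_le G n"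
  by (simp add: entries_le_def)

lemma entries_le_mono: "m \<le> n \<Longrightarrow> entries_le G m \<subseteq> entries_le G n"
  unfolding entries_le_def by (intro insert_mono image_mono Collect_mono) (meson of_nat_mono order_trans)

lemma entries_le_stretch:
  assumes "x \<in> entries_le G n" "pr G v \<in> prios G"
  shows "stretch G x v \<in> entries_le G (Suc n)"
proof (cases x)
  case (Value \<eta>)
  then have \<eta>: "0 \<le> entry \<eta> k" "entry \<eta> k \<le> int n" "k \<notin> prios G \<Longrightarrow> entry \<eta> k = 0" for k
    using assms by (auto simp: entries_le_def)
  have "entry \<eta> k \<le> 1 + int n" for k using \<eta>(2)[of k] by simp
  then show ?thesis
    using \<eta> assms(2) unfolding entries_le_def Value by (auto simp: max_def)
qed (simp add: entries_le_def)

lemma finite_entries_le: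
  assumes "finite (prios G)"
  shows "finite (entries_le G n)"
proof -
  let ?H = "{\<eta>. \<forall>k. 0 \<le> entry \<eta> k \<and> entry \<eta> k \<le> int n \<and> (k \<notin> prios G \<longrightarrow> entry \<eta> k = 0)}"
  have "finite {f. \<forall>k. (k \<in> prios G \<longrightarrow> f k \<in> {0..int n}) \<and> (k \<notin> prios G \<longrightarrow> f k = 0)}"
    using assms by (intro finite_set_of_finite_funs) auto
  then have "finite (entry ` ?H)"
    by (rule finite_subset[rotated]) auto
  moreover have "inj_on entry ?H" by (simp add: inj_on_def entry_inject)
  ultimately have "finite ?H" by (simp add: finite_image_iff)
  then show ?thesis by (simp add: entries_le_def)
qed

context finite_parity_game
begin

section \<open>Lifts and escape forfeits\<close>

lemma lift_other: "v \<notin> S \<or> v \<notin> positions G \<Longrightarrow> lift G \<mu> S T v = \<mu> v"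
  by (auto simp: lift_def positions_def)

lemma lift_attained:
  assumes "v \<in> S" "v \<in> positions G" "Mv G v \<inter> T \<noteq> {}"
  obtains u where "u \<in> Mv G v \<inter> T" "lift G \<mu> S T v = stretch G (\<mu> u) v"
proof -
  let ?A = "(\<lambda>u. stretch G (\<mu> u) v) ` (Mv G v \<inter> T)"
  have A: "finite ?A" "?A \<noteq> {}" using finite_Mv assms by auto
  have "lift G \<mu> S T v \<in> ?A"
    using assms(2) by (rule pos_cases) (use Max_in[OF A] Min_in[OF A] assms(1) in \<open>simp_all add: lift_def\<close>)
  then show ?thesis using that by auto
qed

lemma lift_ge_pos0:
  assumes "v \<in> S" "v \<in> pos0 G" "u \<in> Mv G v \<inter> T"
  shows "stretch G (\<mu> u) v \<le> lift G \<mu> S T v"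
  using assms finite_Mv by (auto simp: lift_def intro!: Max_ge)

lemma lift_le_pos1:
  assumes "v \<in> S" "v \<in> pos1 G" "u \<in> Mv G v \<inter> T"
  shows "lift G \<mu> S T v \<le> stretch G (\<mu> u) v"
  using assms finite_Mv pos_disjoint by (auto simp: lift_def intro!: Min_le)

text \<open>Subtracting a fixed finite measure is monotone and so commutes with the maximum or
  minimum over the exits. The forfeit is thus exactly the rise caused by a lift through the
  exits.\<close>

lemma bef_eq_lift:
  assumes "v \<in> esc G \<mu> Q" "v \<in> S" "\<mu> v \<noteq> Top" "Mv G v - Q \<noteq> {}"
  shows "bef G \<mu> Q v = difference (lift G \<mu> S (positions G - Q) v) (\<mu> v)"
proof -
  obtain \<xi> where \<xi>: "\<mu> v = Value \<xi>" using assms(3) by (cases "\<mu> v") auto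
  have Mv: "Mv G v \<inter> (positions G - Q) = Mv G v - Q" using Mv_subset by auto
  have fin: "finite ((\<lambda>u. stretch G (\<mu> u) v) ` (Mv G v - Q))"
    and ne: "(\<lambda>u. stretch G (\<mu> u) v) ` (Mv G v - Q) \<noteq> {}"
    using finite_Mv assms(4) by auto
  have "v \<in> positions G" using assms(1) by (auto simp: esc_def positions_def)
  then show ?thesis
    using mono_Max_commute[OF difference_mono fin ne, of \<xi>]
      mono_Min_commute[OF difference_mono fin ne, of \<xi>] assms(1,2)
    by (elim pos_cases) (simp_all add: bef_def lift_def \<xi> Mv image_image)
qed

section \<open>The invariant of the solver and its preservation by the first operator\<close>

definition regress :: "'v measure_fun \<Rightarrow> bool" where
  "regress \<mu> \<longleftrightarrow>
     (\<forall>v\<in>pos0 G. \<exists>u\<in>Mv G v. \<mu> v \<le> stretch G (\<mu> u) v) \<and>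
     (\<forall>v\<in>pos1 G. \<forall>u\<in>Mv G v. \<mu> v \<le> stretch G (\<mu> u) v)"

text \<open>Regress alone does not justify the value \<open>Top\<close> (the constant
  \<open>Top\<close> function satisfies it), so the last clause carries the winning guarantee for
  these positions.\<close>

definition sound :: "'v measure_fun \<Rightarrow> bool" where
  "sound \<mu> \<longleftrightarrow> (\<forall>v\<in>positions G. admissible G v (\<mu> v)) \<and> regress \<mu> \<and>
     dominion Player0 {v \<in> positions G. \<mu> v = Top}"

text \<open>Truncation keeps the entry at the priority of \<open>v\<close>, and admissibility makes
  this entry positive unless the measure is zero.\<close>

lemma den_bot_eq:
  assumes "sound \<mu>"
  shows "den_bot G \<mu> = {v \<in> positions G. \<mu> v = Value 0}"
proof -
  have "trunc G (\<mu> v) v = Value 0 \<longleftrightarrow> \<mu> v = Value 0" if "v \<in> positions G" for v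
  proof (cases "\<mu> v")
    case (Value \<eta>)
    have "\<eta> = 0 \<or> 0 < entry \<eta> (pr G v)"
      using assms that Value unfolding sound_def admissible_def by blast
    moreover have "keep_from (pr G v) 0 = 0" by (intro altlex_eqI) simp
    moreover have "keep_from (pr G v) \<eta> \<noteq> 0" if "0 < entry \<eta> (pr G v)"
      using that entry_keep_from[of "pr G v" \<eta> "pr G v"] by (metis entry_simps(1) less_irrefl order_refl)
    ultimately show ?thesis using Value by auto
  qed simp
  then show ?thesis by (auto simp: den_bot_def)
qed

lemma den_plus_eq:
  assumes "sound \<mu>"
  shows "den_plus G \<mu> = {v \<in> positions G. \<mu> v \<noteq> Value 0}"
  using den_bot_eq[OF assms] by (auto simp: den_plus_def)

lemma sound_mf_bot: "sound mf_bot"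
proof -
  have "dominion Player0 {}"
    by (simp add: dominion_def traps_def wins_within_def)
  then show ?thesis
    using Mv_nonempty zero_le_stretch
    by (auto simp: sound_def mf_bot_def admissible_zero regress_def positions_def ex_in_conv)
qed

lemma prg_bot_inflationary:
  assumes "sound \<mu>"
  shows "\<mu> v \<le> prg_bot G \<mu> v"
proof (cases "v \<in> den_bot G \<mu>")
  case True
  then have v: "v \<in> positions G" "\<mu> v = Value 0" using den_bot_eq[OF assms] by auto
  then have "Mv G v \<inter> positions G \<noteq> {}" using Mv_nonempty Mv_subset by blast
  then obtain u where "prg_bot G \<mu> v = stretch G (\<mu> u) v"
    using lift_attained[OF True v(1)] unfolding prg_bot_def by metis
  then show ?thesis using v zero_le_stretch by simp
qed (simp add: prg_bot_def lift_other)

text \<open>Lifted values are stretches of old measures, which lie below the new ones, so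
  monotonicity of \<open>stretch\<close> gives regress. As \<open>stretch\<close> yields
  \<open>Top\<close> only from \<open>Top\<close>, new \<open>Top\<close> positions are one move
  away from old ones: by some move of player 0, by all moves of player 1.\<close>

lemma sound_prg_bot:
  assumes "sound \<mu>"
  shows "sound (prg_bot G \<mu>)"
proof -
  let ?\<nu> = "prg_bot G \<mu>"
  note bot = den_bot_eq[OF assms]
  note infl = prg_bot_inflationary[OF assms]
  have adm: "\<And>v. v \<in> positions G \<Longrightarrow> admissible G v (\<mu> v)"
    and reg0: "\<And>v. v \<in> pos0 G \<Longrightarrow> \<exists>u\<in>Mv G v. \<mu> v \<le> stretch G (\<mu> u) v"
    and reg1: "\<And>v u. v \<in> pos1 G \<Longrightarrow> u \<in> Mv G v \<Longrightarrow> \<mu> v \<le> stretch G (\<mu> u) v"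
    and dom: "dominion Player0 {v \<in> positions G. \<mu> v = Top}"
    using assms by (auto simp: sound_def regress_def)
  have mono: "stretch G (\<mu> u) v \<le> stretch G (?\<nu> u) v" for u v
    by (intro stretch_mono infl)
  have att: "\<exists>u\<in>Mv G v. ?\<nu> v = stretch G (\<mu> u) v" if "v \<in> den_bot G \<mu>" for v
  proof -
    have "v \<in> positions G" using that bot by simp
    moreover have "Mv G v \<inter> positions G \<noteq> {}" using calculation Mv_nonempty Mv_subset by blast
    ultimately show ?thesis
      using lift_attained[OF that, of "positions G" \<mu>] unfolding prg_bot_def by (metis IntE)
  qed
  have other: "?\<nu> v = \<mu> v" if "v \<notin> den_bot G \<mu>" for v
    using that by (simp add: prg_bot_def lift_other)
  have "admissible G v (?\<nu> v)" if "v \<in> positions G" for v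
    using att[of v] other[of v] adm admissible_stretch Mv_subset that by (metis subsetD)
  moreover have "\<exists>u\<in>Mv G v. ?\<nu> v \<le> stretch G (?\<nu> u) v" if "v \<in> pos0 G" for v
    using att[of v] other[of v] reg0[OF that] mono order_trans by metis
  moreover have le1: "?\<nu> v \<le> stretch G (\<mu> u) v" if "v \<in> pos1 G" "u \<in> Mv G v" for u v
    using lift_le_pos1[of v "den_bot G \<mu>" u "positions G" \<mu>] Mv_subset that other[of v] reg1
    unfolding prg_bot_def by (cases "v \<in> den_bot G \<mu>") auto
  moreover have "dominion Player0 {v \<in> positions G. ?\<nu> v = Top}"
  proof -
    let ?D = "{v \<in> positions G. \<mu> v = Top}" and ?D' = "{v \<in> positions G. ?\<nu> v = Top}"
    have "?\<nu> v = Top" if "\<mu> v = Top" for v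
      using infl[of v] that less_eq_top_is_Top by metis
    then have sub: "?D \<subseteq> ?D'" by auto
    define \<tau> where "\<tau> v = (SOME u. u \<in> Mv G v \<and> \<mu> u = Top)" for v
    have \<tau>: "\<tau> v \<in> Mv G v \<inter> ?D" if "v \<in> ?D' - ?D" for v
    proof -
      have "\<exists>u. u \<in> Mv G v \<and> \<mu> u = Top"
        using att[of v] other[of v] that by (auto simp: eq_commute[of Top])
      then have "\<tau> v \<in> Mv G v \<and> \<mu> (\<tau> v) = Top" unfolding \<tau>_def by (rule someI_ex)
      then show ?thesis using Mv_subset by auto
    qed
    have opp: "Mv G v \<subseteq> ?D" if "v \<in> ?D' - ?D" "v \<notin> pos0 G" for v
    proof
      fix u assume u: "u \<in> Mv G v"
      have "v \<in> pos1 G" using that by (auto simp: positions_def)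
      then have "stretch G (\<mu> u) v = Top" using le1[OF _ u] that(1) less_eq_top_is_Top[of "stretch G (\<mu> u) v"] by simp
      then show "u \<in> ?D" using u Mv_subset by auto
    qed
    have "traps Player0 \<tau> (?D' - ?D) ?D'"
      unfolding traps_def owned.simps
    proof
      fix v assume v: "v \<in> ?D' - ?D"
      show "(v \<in> pos0 G \<longrightarrow> \<tau> v \<in> Mv G v \<inter> ?D') \<and> (v \<notin> pos0 G \<longrightarrow> Mv G v \<subseteq> ?D')"
        using \<tau>[OF v] opp[OF v] sub by blast
    qed
    \<comment> \<open>This holds vacuously: no play stays among the added positions, since its first
      move already enters \<open>?D\<close>.\<close>
    moreover have "wins_within Player0 \<tau> (?D' - ?D)"
      unfolding wins_within_def
    proof (intro allI impI, elim conjE)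
      fix \<pi> assume \<pi>: "is_play G \<pi>" "range \<pi> \<subseteq> ?D' - ?D" "follows Player0 \<tau> \<pi>"
      have "\<pi> n \<in> ?D' - ?D" for n using \<pi>(2) by blast
      from this[of 0] this[of 1] have v: "\<pi> 0 \<in> ?D' - ?D" "\<pi> 1 \<notin> ?D" by auto
      have "\<pi> 1 \<in> Mv G (\<pi> 0)" using \<pi>(1) by (simp add: is_play_def)
      moreover have "\<pi> 1 = \<tau> (\<pi> 0)" if "\<pi> 0 \<in> pos0 G"
        using \<pi>(3) that by (simp add: follows_def)
      ultimately have "\<pi> 1 \<in> ?D"
        using \<tau>[OF v(1)] opp[OF v(1)] by (cases "\<pi> 0 \<in> pos0 G") auto
      with v(2) show "wins G Player0 \<pi>" by blast
    qed
    ultimately show ?thesis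
      using dominion_extend[OF dom sub] by auto
  qed
  ultimately show ?thesis
    using mono order_trans unfolding sound_def regress_def by blast
qed

section \<open>The escape loop\<close>


text \<open>
  As in Dijkstra's algorithm, forfeits never decrease during the loop: the positions that have
  already left \<open>Q\<close> were raised by at most \<open>c\<close>, and the remaining ones will be raised by at least \<open>c\<close>.
\<close>

definition forfeit_level :: "'v measure_fun \<Rightarrow> 'v set \<Rightarrow> 'v measure_fun \<Rightarrow> altlex \<Rightarrow> bool" where
  "forfeit_level \<mu> Q \<nu> c \<longleftrightarrow>
     (\<forall>v\<in>den_plus G \<mu> - Q. \<exists>\<eta> d. \<mu> v = Value \<eta> \<and> \<nu> v = Value (\<eta> + d) \<and> 0 \<le> d \<and> d \<le> c) \<and>
     (\<forall>x\<in>Q. Value c \<le> bef G \<nu> Q x)"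

text \<open>Each round enlarges \<open>positions G - Q\<close>, which pays for one more stretch in
  the entry bound. The alternative \<open>stretch G (\<mu> u) v < \<mu> v\<close> refers to the
  original \<open>\<mu>\<close>, so later rises of \<open>u\<close> cannot invalidate it.\<close>

definition loop_inv :: "'v measure_fun \<Rightarrow> 'v set \<Rightarrow> 'v measure_fun \<Rightarrow> bool" where
  "loop_inv \<mu> Q \<nu> \<longleftrightarrow>
     Q \<subseteq> den_plus G \<mu> \<and>
     (\<forall>v. v \<notin> den_plus G \<mu> - Q \<longrightarrow> \<nu> v = \<mu> v) \<and>
     (\<exists>c\<ge>0. forfeit_level \<mu> Q \<nu> c) \<and>
     (\<forall>v\<in>positions G - Q. admissible G v (\<nu> v) \<and> \<nu> v \<in> entries_le G (card (positions G - Q))) \<and>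
     (\<forall>v\<in>den_plus G \<mu> - Q. \<exists>u\<in>Mv G v - Q. \<nu> v = stretch G (\<nu> u) v) \<and>
     (\<forall>v\<in>(den_plus G \<mu> - Q) \<inter> pos0 G. \<forall>u\<in>Mv G v.
        u \<notin> Q \<and> stretch G (\<nu> u) v \<le> \<nu> v \<or> stretch G (\<mu> u) v < \<mu> v) \<and>
     (\<forall>v\<in>(den_plus G \<mu> - Q) \<inter> pos1 G. \<forall>u\<in>Mv G v - Q. \<nu> v \<le> stretch G (\<nu> u) v)"

lemma loop_invD:
  assumes "loop_inv \<mu> Q \<nu>"
  shows "Q \<subseteq> den_plus G \<mu>"
    and "v \<notin> den_plus G \<mu> - Q \<Longrightarrow> \<nu> v = \<mu> v"
    and "\<exists>c\<ge>0. forfeit_level \<mu> Q \<nu> c"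
    and "v \<in> positions G - Q \<Longrightarrow> admissible G v (\<nu> v)"
    and "v \<in> positions G - Q \<Longrightarrow> \<nu> v \<in> entries_le G (card (positions G - Q))"
    and "v \<in> den_plus G \<mu> - Q \<Longrightarrow> \<exists>u\<in>Mv G v - Q. \<nu> v = stretch G (\<nu> u) v"
    and "v \<in> den_plus G \<mu> - Q \<Longrightarrow> v \<in> pos0 G \<Longrightarrow> u \<in> Mv G v \<Longrightarrow>
      u \<notin> Q \<and> stretch G (\<nu> u) v \<le> \<nu> v \<or> stretch G (\<mu> u) v < \<mu> v"
    and "v \<in> den_plus G \<mu> - Q \<Longrightarrow> v \<in> pos1 G \<Longrightarrow> u \<in> Mv G v - Q \<Longrightarrow> \<nu> v \<le> stretch G (\<nu> u) v"
  using assms unfolding loop_inv_def by blast+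

lemma esc_pos0D:
  assumes "v \<in> esc G \<nu> Q" "v \<in> pos0 G" "u \<in> Mv G v" "u \<in> Q"
  shows "stretch G (\<nu> u) v < \<nu> v"
  using assms pos_disjoint by (auto simp: esc_def)

text \<open>A maximum needs one good exit, a minimum needs all exits to be good; without an escape
  the forfeit is \<open>Top\<close>.\<close>

lemma le_bef:
  assumes "x \<in> Q"
    and "x \<in> esc G \<nu> Q \<Longrightarrow> x \<in> pos0 G \<Longrightarrow>
      \<exists>u\<in>Mv G x - Q. c \<le> difference (stretch G (\<nu> u) x) (\<nu> x)"
    and "\<And>u. x \<in> esc G \<nu> Q \<Longrightarrow> x \<in> pos1 G \<Longrightarrow> u \<in> Mv G x - Q \<Longrightarrow>
      c \<le> difference (stretch G (\<nu> u) x) (\<nu> x)"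
  shows "c \<le> bef G \<nu> Q x"
proof -
  let ?A = "(\<lambda>u. difference (stretch G (\<nu> u) x) (\<nu> x)) ` (Mv G x - Q)"
  have fin: "finite ?A" using finite_Mv by simp
  consider "x \<notin> esc G \<nu> Q" | "x \<in> esc G \<nu> Q" "x \<in> pos0 G" "x \<notin> pos1 G"
    | "x \<in> esc G \<nu> Q" "x \<in> pos1 G" "x \<notin> pos0 G"
    using pos_disjoint by (auto simp: esc_def)
  then show ?thesis
  proof cases
    case 1
    then show ?thesis by (simp add: bef_def)
  next
    case 2
    then obtain u where "u \<in> Mv G x - Q" "c \<le> difference (stretch G (\<nu> u) x) (\<nu> x)"
      using assms(2) by blast
    then have "c \<le> Max ?A" using Max_ge[OF fin] order_trans by blast
    then show ?thesis using 2 by (simp add: bef_def)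
  next
    case 3
    then have "?A \<noteq> {}" by (auto simp: esc_def)
    then have "c \<le> Min ?A" using 3 assms(3) by (auto simp: Min_ge_iff[OF fin])
    then show ?thesis using 3 by (simp add: bef_def)
  qed
qed

section \<open>Preservation of the invariant by one round of the escape loop\<close>

context
  fixes \<mu> :: "'v measure_fun"
  assumes sound: "sound \<mu>"
begin

lemma sound_admissible: "v \<in> positions G \<Longrightarrow> admissible G v (\<mu> v)"
  and regress_pos0: "v \<in> pos0 G \<Longrightarrow> \<exists>u\<in>Mv G v. \<mu> v \<le> stretch G (\<mu> u) v"
  and regress_pos1: "v \<in> pos1 G \<Longrightarrow> u \<in> Mv G v \<Longrightarrow> \<mu> v \<le> stretch G (\<mu> u) v"
  using sound by (auto simp: sound_def regress_def)

lemma den_plus_pos: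
  assumes "v \<in> den_plus G \<mu>" "\<mu> v = Value \<eta>"
  shows "0 < \<eta>"
  using assms sound_admissible[of v] by (auto simp: den_plus_eq[OF sound] admissible_def)

text \<open>A positive measure is not clipped, so the regress condition is linear there.\<close>

lemma regress_linear:
  assumes "v \<in> den_plus G \<mu>" "\<mu> v = Value \<eta>" "\<mu> u = Value \<theta>" "\<mu> v \<le> stretch G (\<mu> u) v"
  shows "\<eta> \<le> \<theta> + delta (pr G v)"
proof -
  have "\<eta> \<le> max 0 (\<theta> + delta (pr G v))" using assms(4) by (simp add: assms(2,3))
  then show ?thesis using den_plus_pos[OF assms(1,2)] by (simp add: le_max_iff_disj not_le[symmetric])
qed

text \<open>Outside \<open>Q\<close> a position is either zero and untouched or has left the loop
  with a finite rise, so none has measure \<open>Top\<close>.\<close>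

lemma outside_value:
  assumes "loop_inv \<mu> Q \<nu>" "u \<in> positions G" "u \<notin> Q"
  obtains \<theta> d where "\<mu> u = Value \<theta>" "\<nu> u = Value (\<theta> + d)" "0 \<le> d"
proof (cases "u \<in> den_plus G \<mu>")
  case True
  then show ?thesis
    using loop_invD(3)[OF assms(1)] assms(3) that unfolding forfeit_level_def by blast
next
  case False
  then have "\<mu> u = Value 0" "\<nu> u = Value 0"
    using loop_invD(2)[OF assms(1), of u] assms(2) by (auto simp: den_plus_eq[OF sound])
  then show ?thesis using that[of 0 0] by simp
qed

lemma loop_ge:
  assumes "loop_inv \<mu> Q \<nu>"
  shows "\<mu> v \<le> \<nu> v"
proof (cases "v \<in> den_plus G \<mu> - Q")
  case True
  then have "v \<in> positions G" "v \<notin> Q" by (auto simp: den_plus_eq[OF sound])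
  then obtain \<theta> d where "\<mu> v = Value \<theta>" "\<nu> v = Value (\<theta> + d)" "0 \<le> d"
    using outside_value[OF assms] by metis
  then show ?thesis by simp
qed (use loop_invD(2)[OF assms] in simp)

lemma loop_stretch_ge:
  assumes "loop_inv \<mu> Q \<nu>"
  shows "stretch G (\<mu> u) v \<le> stretch G (\<nu> u) v"
  using loop_ge[OF assms] by (rule stretch_mono)

text \<open>Some regress move leads out of \<open>Q\<close>: for player 0, a regress move inside
  \<open>Q\<close> would contradict the strict loss required of an escape position; for player 1, an
  exit exists and regress holds for all moves. The target has finite measure, hence so has
  \<open>v\<close>.\<close>

lemma esc_facts:
  assumes inv: "loop_inv \<mu> Q \<nu>" and v: "v \<in> esc G \<nu> Q"
  shows "v \<in> Q" "v \<in> den_plus G \<mu>" "v \<in> positions G" "\<nu> v = \<mu> v" "Mv G v - Q \<noteq> {}" "\<mu> v \<noteq> Top"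
proof -
  show vQ: "v \<in> Q" using v by (auto simp: esc_def)
  then show vp: "v \<in> den_plus G \<mu>" using loop_invD(1)[OF inv] by blast
  then show "v \<in> positions G" by (simp add: den_plus_eq[OF sound])
  show eq: "\<nu> v = \<mu> v" using loop_invD(2)[OF inv, of v] vQ by blast
  have "\<exists>u\<in>Mv G v - Q. \<mu> v \<le> stretch G (\<mu> u) v"
  proof (cases "v \<in> pos0 G")
    case True
    then obtain u where u: "u \<in> Mv G v" "\<mu> v \<le> stretch G (\<mu> u) v" using regress_pos0 by blast
    have "\<nu> v \<le> stretch G (\<nu> u) v" using u(2) loop_stretch_ge[OF inv, of u v] eq by simp
    then have "u \<notin> Q" using esc_pos0D[OF v True u(1)] by (auto dest: leD)
    then show ?thesis using u by blast
  next
    case False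
    then have "v \<in> pos1 G" "Mv G v - Q \<noteq> {}" using v by (auto simp: esc_def)
    then show ?thesis using regress_pos1 by blast
  qed
  then obtain u where u: "u \<in> Mv G v" "u \<notin> Q" "\<mu> v \<le> stretch G (\<mu> u) v" by blast
  then show "Mv G v - Q \<noteq> {}" by blast
  have "u \<in> positions G" using u(1) Mv_subset by blast
  then have "\<mu> u \<noteq> Top" by (rule outside_value[OF inv _ u(2)]) simp
  then show "\<mu> v \<noteq> Top" using u(3) less_eq_top_is_Top[of "stretch G (\<mu> u) v"] by auto
qed

text \<open>Every position outside the initial \<open>Q\<close> is zero, and regress makes all
  forfeits nonnegative, so the loop starts at level zero.\<close>

lemma loop_inv_init: "loop_inv \<mu> (den_plus G \<mu>) \<mu>"
proof -
  let ?Q = "den_plus G \<mu>"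
  have bot: "\<mu> v = Value 0" if "v \<in> positions G - ?Q" for v
    using that by (simp add: den_plus_eq[OF sound])
  have diff: "Value 0 \<le> difference (stretch G (\<mu> u) x) (\<mu> x)" if "\<mu> x \<le> stretch G (\<mu> u) x" for u x
    using that by (cases "stretch G (\<mu> u) x"; cases "\<mu> x") auto
  have "Value 0 \<le> bef G \<mu> ?Q x" if x: "x \<in> ?Q" for x
  proof (rule le_bef[OF x])
    assume e: "x \<in> esc G \<mu> ?Q" and x0: "x \<in> pos0 G"
    obtain u where u: "u \<in> Mv G x" "\<mu> x \<le> stretch G (\<mu> u) x" using regress_pos0 x0 by blast
    moreover have "u \<notin> ?Q" using esc_pos0D[OF e x0 u(1)] u(2) by (auto dest: leD)
    ultimately show "\<exists>u\<in>Mv G x - ?Q. Value 0 \<le> difference (stretch G (\<mu> u) x) (\<mu> x)"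
      using diff by blast
  next
    fix u assume "x \<in> pos1 G" "u \<in> Mv G x - ?Q"
    then show "Value 0 \<le> difference (stretch G (\<mu> u) x) (\<mu> x)" using diff regress_pos1 by blast
  qed
  then have "forfeit_level \<mu> ?Q \<mu> 0" by (simp add: forfeit_level_def)
  then show ?thesis
    unfolding loop_inv_def using bot admissible_zero entries_le_zero by auto
qed

text \<open>The new level is the forfeit \<open>a\<close> of the batch \<open>E\<close>. Old exits
  cost at least \<open>a\<close> by minimality, and new exits into \<open>E\<close> cost at least
  \<open>a\<close> because \<open>E\<close> itself rose by exactly \<open>a\<close>. Earlier
  departures of player 1 rose by at most \<open>a\<close>, so their moves into \<open>E\<close> do
  not undercut them.\<close>

lemma loop_inv_step:
  assumes inv: "loop_inv \<mu> Q \<nu>" and ne: "bep G \<nu> Q \<noteq> {}"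
  shows "loop_inv \<mu> (Q - bep G \<nu> Q) (lift G \<nu> (bep G \<nu> Q) (positions G - Q))"
proof -
  define E where "E = bep G \<nu> Q"
  define Q' where "Q' = Q - E"
  define \<nu>' where "\<nu>' = lift G \<nu> E (positions G - Q)"
  note inv1 = loop_invD(1)[OF inv] and inv2 = loop_invD(2)[OF inv]
  obtain c where c: "0 \<le> c" "forfeit_level \<mu> Q \<nu> c" using loop_invD(3)[OF inv] by blast
  have Q_pos: "Q \<subseteq> positions G" using inv1 by (auto simp: den_plus_eq[OF sound])
  have EQ: "E \<subseteq> Q" by (auto simp: E_def bep_def is_arg_min_def)
  obtain e where e: "e \<in> E" using ne by (auto simp: E_def)
  \<comment> \<open>\<open>a\<close> is the common forfeit of the whole batch; it is finite because
    \<open>bep\<close> excludes \<open>Top\<close>.\<close>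
  obtain a where a: "bef G \<nu> Q e = Value a"
    using e by (cases "bef G \<nu> Q e") (auto simp: E_def bep_def)
  have bef_E: "bef G \<nu> Q v = Value a" if "v \<in> E" for v
  proof -
    have "\<not> bef G \<nu> Q v < bef G \<nu> Q e" "\<not> bef G \<nu> Q e < bef G \<nu> Q v"
      using that e EQ by (auto simp: E_def bep_def is_arg_min_def)
    then show ?thesis using a by simp
  qed
  have bef_ge: "Value a \<le> bef G \<nu> Q x" if "x \<in> Q" for x
    using that e a unfolding E_def bep_def is_arg_min_def by (auto simp: not_less)
  have "Value c \<le> bef G \<nu> Q e" using c(2) e EQ by (auto simp: forfeit_level_def)
  then have ca: "c \<le> a" by (simp add: a)
  then have a0: "0 \<le> a" using c(1) by simp
  have E_esc: "v \<in> esc G \<nu> Q" if "v \<in> E" for v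
    using bef_E[OF that] by (auto simp: bef_def split: if_splits)
  note facts = esc_facts[OF inv E_esc]
  have Mv_out: "Mv G v \<inter> (positions G - Q) = Mv G v - Q" for v using Mv_subset by auto
  have \<nu>'_E: "\<exists>\<eta>. \<mu> v = Value \<eta> \<and> \<nu>' v = Value (\<eta> + a)" if v: "v \<in> E" for v
  proof -
    obtain \<eta> where \<eta>: "\<mu> v = Value \<eta>" using facts(6)[OF v] by (cases "\<mu> v") auto
    have "difference (\<nu>' v) (Value \<eta>) = Value a"
      using bef_eq_lift[OF E_esc[OF v] v] facts(4-6)[OF v] bef_E[OF v] \<eta>
      by (simp add: \<nu>'_def)
    then show ?thesis using \<eta> difference_eq_ValueD by blast
  qed
  have \<nu>'_other: "\<nu>' v = \<nu> v" if "v \<notin> E" for v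
    using that by (simp add: \<nu>'_def lift_other)
  have att: "\<exists>u\<in>Mv G v - Q. \<nu>' v = stretch G (\<nu> u) v" if v: "v \<in> E" for v
    using lift_attained[OF v facts(3)[OF v], of "positions G - Q" \<nu>] facts(5)[OF v]
    unfolding Mv_out \<nu>'_def by metis
  have out_same: "\<nu>' u = \<nu> u" if "u \<notin> Q" for u using \<nu>'_other that EQ by blast
  have in_same: "\<nu>' u = \<mu> u" if "u \<in> Q'" for u
    using \<nu>'_other[of u] inv2[of u] that by (auto simp: Q'_def)
  \<comment> \<open>Lifting the positions of \<open>E\<close> by \<open>a\<close> makes their predecessors rise by at least \<open>a\<close>.\<close>
  have push: "\<eta> + a \<le> \<theta>'"
    if prem: "x \<in> den_plus G \<mu>" "\<mu> x = Value \<eta>" "u \<in> E" "\<mu> x \<le> stretch G (\<mu> u) x"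
      "stretch G (\<nu>' u) x = Value \<theta>'" for x u \<eta> \<theta>'
  proof -
    obtain \<theta> where \<theta>: "\<mu> u = Value \<theta>" "\<nu>' u = Value (\<theta> + a)" using \<nu>'_E[OF prem(3)] by blast
    have "\<eta> \<le> \<theta> + delta (pr G x)" using regress_linear[OF prem(1,2) \<theta>(1) prem(4)] .
    then have "\<eta> + a \<le> \<theta> + a + delta (pr G x)" by (simp add: algebra_simps)
    also have "\<dots> \<le> \<theta>'" using prem(5) \<theta>(2) by auto
    finally show ?thesis .
  qed
  have push_diff: "Value a \<le> difference (stretch G (\<nu>' u) x) (\<mu> x)"
    if "x \<in> den_plus G \<mu>" "u \<in> E" "\<mu> x \<le> stretch G (\<mu> u) x" for x u
  proof (cases "\<mu> x")
    case (Value \<eta>)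
    then show ?thesis
      using push[OF that(1) Value that(2,3)]
      by (cases "stretch G (\<nu>' u) x") (auto simp: le_diff_eq add.commute)
  qed simp
  \<comment> \<open>For player 1 any exit makes \<open>x\<close> an escape position, and every exit
    costs at least the minimum, which is at least \<open>a\<close>.\<close>
  have old_diff: "Value a \<le> difference (stretch G (\<nu> u) x) (\<mu> x)"
    if "x \<in> pos1 G" "x \<in> Q" "u \<in> Mv G x - Q" for x u
  proof -
    have x: "x \<in> esc G \<nu> Q" using that by (auto simp: esc_def)
    let ?A = "(\<lambda>u. difference (stretch G (\<nu> u) x) (\<nu> x)) ` (Mv G x - Q)"
    have "bef G \<nu> Q x = Min ?A" using x that(1) pos_disjoint by (auto simp: bef_def)
    also have "\<dots> \<le> difference (stretch G (\<nu> u) x) (\<nu> x)"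
      using that finite_Mv by (intro Min_le) auto
    finally show ?thesis using bef_ge[OF that(2)] inv2[of x] that(2) by simp
  qed
  have level: "Value a \<le> bef G \<nu>' Q' x" if x: "x \<in> Q'" for x
  proof (rule le_bef[OF x])
    have xQ: "x \<in> Q" and xp: "x \<in> den_plus G \<mu>" using x inv1 by (auto simp: Q'_def)
    have eq: "\<nu>' x = \<mu> x" "\<nu> x = \<mu> x" using in_same[OF x] inv2[of x] xQ by auto
    {
      assume e': "x \<in> esc G \<nu>' Q'" and x0: "x \<in> pos0 G"
      show "\<exists>u\<in>Mv G x - Q'. Value a \<le> difference (stretch G (\<nu>' u) x) (\<nu>' x)"
      proof (cases "x \<in> esc G \<nu> Q")
        case True
        let ?A = "(\<lambda>u. difference (stretch G (\<nu> u) x) (\<nu> x)) ` (Mv G x - Q)"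
        have "finite ?A" "?A \<noteq> {}" using finite_Mv esc_facts(5)[OF inv True] by auto
        then have "Max ?A \<in> ?A" by (rule Max_in)
        then obtain u where u: "u \<in> Mv G x - Q" "Max ?A = difference (stretch G (\<nu> u) x) (\<nu> x)"
          by auto
        have "bef G \<nu> Q x = Max ?A" using True x0 by (auto simp: bef_def)
        then have "Value a \<le> difference (stretch G (\<nu> u) x) (\<nu> x)" using bef_ge[OF xQ] u(2) by simp
        then show ?thesis using u(1) eq out_same[of u] by (intro bexI[of _ u]) (auto simp: Q'_def)
      next
        case False
        \<comment> \<open>Before the round, \<open>x\<close> had a move inside \<open>Q\<close>
          without loss. As \<open>x\<close> is now an escape position, the target of this move must
          have left with \<open>E\<close>.\<close>
        then obtain u where u: "u \<in> Mv G x" "u \<in> Q" "\<nu> x \<le> stretch G (\<nu> u) x"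
          using xQ x0 by (force simp: esc_def not_less)
        have \<nu>u: "\<nu> u = \<mu> u" using inv2[of u] u(2) by blast
        have "u \<in> E"
        proof (rule ccontr)
          assume "u \<notin> E"
          then have uQ': "u \<in> Q'" using u(2) by (simp add: Q'_def)
          then have "stretch G (\<nu>' u) x < \<nu>' x"
            using esc_pos0D[OF e' x0 u(1)] by simp
          then show False using u(3) \<nu>u in_same[OF uQ'] eq by simp
        qed
        then show ?thesis
          using push_diff[OF xp \<open>u \<in> E\<close>] u \<nu>u eq by (intro bexI[of _ u]) (auto simp: Q'_def)
      qed
    next
      fix u assume x1: "x \<in> pos1 G" and u: "u \<in> Mv G x - Q'"
      show "Value a \<le> difference (stretch G (\<nu>' u) x) (\<nu>' x)"
      proof (cases "u \<in> Q")
        case True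
        then have "u \<in> E" using u by (simp add: Q'_def)
        then show ?thesis using push_diff[OF xp] regress_pos1[OF x1] u eq by simp
      next
        case False
        then show ?thesis using old_diff[OF x1 xQ] u eq out_same by simp
      qed
    }
  qed
  have raise: "\<exists>\<eta> d. \<mu> v = Value \<eta> \<and> \<nu>' v = Value (\<eta> + d) \<and> 0 \<le> d \<and> d \<le> a"
    if v: "v \<in> den_plus G \<mu> - Q'" for v
  proof (cases "v \<in> E")
    case True
    then show ?thesis using \<nu>'_E a0 by blast
  next
    case False
    then have "v \<in> den_plus G \<mu> - Q" using v by (auto simp: Q'_def)
    then obtain \<eta> d where "\<mu> v = Value \<eta>" "\<nu> v = Value (\<eta> + d)" "0 \<le> d" "d \<le> c"
      using c(2) unfolding forfeit_level_def by blast
    then show ?thesis using \<nu>'_other[OF False] ca order_trans by metis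
  qed
  have split: "v \<in> E \<or> v \<in> A - Q" if "v \<in> A - Q'" for v A using that by (auto simp: Q'_def)
  have "forfeit_level \<mu> Q' \<nu>' a" using level raise by (simp add: forfeit_level_def)
  moreover have "admissible G v (\<nu>' v) \<and> \<nu>' v \<in> entries_le G (card (positions G - Q'))"
    if v: "v \<in> positions G - Q'" for v
  proof -
    \<comment> \<open>At least one position has left, which makes room in the entry bound for one
      more stretch.\<close>
    have "positions G - Q \<subset> positions G - Q'"
      using e EQ Q_pos by (auto simp: Q'_def)
    then have card: "Suc (card (positions G - Q)) \<le> card (positions G - Q')"
      using finite_positions by (intro Suc_leI psubset_card_mono) auto
    show ?thesis
    proof (cases "v \<in> E")
      case True
      then obtain u where u: "u \<in> Mv G v - Q" "\<nu>' v = stretch G (\<nu> u) v" using att by blast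
      then have u': "u \<in> positions G - Q" using Mv_subset by auto
      then show ?thesis
        using u(2) admissible_stretch[OF loop_invD(4)[OF inv u']]
          entries_le_stretch[OF loop_invD(5)[OF inv u'] pr_in_prios] entries_le_mono[OF card] v
        by auto
    next
      case False
      then have "v \<in> positions G - Q" using v by (auto simp: Q'_def)
      then show ?thesis
        using loop_invD(4,5)[OF inv] \<nu>'_other[OF False] entries_le_mono[OF Suc_leD[OF card]] by auto
    qed
  qed
  moreover have "\<exists>u\<in>Mv G v - Q'. \<nu>' v = stretch G (\<nu>' u) v" if v: "v \<in> den_plus G \<mu> - Q'" for v
  proof -
    have "\<exists>u\<in>Mv G v - Q. \<nu>' v = stretch G (\<nu> u) v"
      using split[OF v] att[of v] loop_invD(6)[OF inv, of v] out_same[of v] by auto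
    then obtain u where "u \<in> Mv G v - Q" "\<nu>' v = stretch G (\<nu> u) v" by blast
    then show ?thesis using out_same[of u] by (intro bexI[of _ u]) (auto simp: Q'_def)
  qed
  moreover have "u \<notin> Q' \<and> stretch G (\<nu>' u) v \<le> \<nu>' v \<or> stretch G (\<mu> u) v < \<mu> v"
    if v: "v \<in> den_plus G \<mu> - Q'" "v \<in> pos0 G" "u \<in> Mv G v" for u v
  proof (cases "v \<in> E")
    case True
    show ?thesis
    proof (cases "u \<in> Q")
      case True
      \<comment> \<open>A move of an escape position into \<open>Q\<close> loses strictly, and
        \<open>\<nu>\<close> agrees with \<open>\<mu>\<close> on \<open>Q\<close>; this is the
        second alternative.\<close>
      then have "stretch G (\<nu> u) v < \<nu> v"
        using esc_pos0D[OF E_esc[OF \<open>v \<in> E\<close>] v(2,3)] by simp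
      then show ?thesis using inv2[of u] inv2[of v] True EQ \<open>v \<in> E\<close> by auto
    next
      case False
      then have "stretch G (\<nu> u) v \<le> \<nu>' v"
        using lift_ge_pos0[OF \<open>v \<in> E\<close> v(2), of u "positions G - Q"] v(3) Mv_subset
        by (auto simp: \<nu>'_def)
      then show ?thesis using False out_same by (simp add: Q'_def)
    qed
  next
    case False
    then have "v \<in> den_plus G \<mu> - Q" using v(1) by (auto simp: Q'_def)
    then show ?thesis
      using loop_invD(7)[OF inv _ v(2,3)] \<nu>'_other[OF False] out_same[of u] by (auto simp: Q'_def)
  qed
  moreover have "\<nu>' v \<le> stretch G (\<nu>' u) v"
    if v: "v \<in> den_plus G \<mu> - Q'" "v \<in> pos1 G" "u \<in> Mv G v - Q'" for u v
  proof (cases "u \<in> Q")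
    case True
    then have uE: "u \<in> E" using v(3) by (simp add: Q'_def)
    \<comment> \<open>The value of \<open>v\<close> rose by at most \<open>a\<close>, while the
      value through \<open>u\<close> lies at least \<open>a\<close> above
      \<open>\<mu> v\<close>.\<close>
    obtain \<eta> d where \<eta>: "\<mu> v = Value \<eta>" "\<nu>' v = Value (\<eta> + d)" "d \<le> a" using raise[OF v(1)] by blast
    show ?thesis
    proof (cases "stretch G (\<nu>' u) v")
      case (Value \<theta>)
      have "\<eta> + d \<le> \<eta> + a" using \<eta>(3) by simp
      also have "\<dots> \<le> \<theta>"
        using push[OF _ \<eta>(1) uE _ Value] v regress_pos1[OF v(2)] by blast
      finally show ?thesis using Value \<eta>(2) by simp
    qed simp
  next
    case False
    show ?thesis
    proof (cases "v \<in> E")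
      case True
      then show ?thesis
        using lift_le_pos1[OF True v(2), of u "positions G - Q" \<nu>] v(3) False Mv_subset out_same
        by (auto simp: \<nu>'_def)
    next
      case vE: False
      then have "v \<in> den_plus G \<mu> - Q" using v(1) by (auto simp: Q'_def)
      then show ?thesis
        using loop_invD(8)[OF inv _ v(2), of u] \<nu>'_other[OF vE] out_same[OF False] v(3) False by auto
    qed
  qed
  moreover have "Q' \<subseteq> den_plus G \<mu>" using inv1 by (auto simp: Q'_def)
  moreover have "\<nu>' v = \<mu> v" if "v \<notin> den_plus G \<mu> - Q'" for v
  proof -
    have "v \<notin> E" using that inv1 EQ by (auto simp: Q'_def)
    then show ?thesis using that \<nu>'_other inv2[of v] by (auto simp: Q'_def)
  qed
  ultimately have "loop_inv \<mu> Q' \<nu>'"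
    unfolding loop_inv_def using a0 by blast
  then show ?thesis by (simp add: Q'_def \<nu>'_def E_def)
qed

end

section \<open>Termination and outcome of the escape loop\<close>

lemma prg_plus_loop:
  assumes sound: "sound \<mu>"
  obtains Q \<nu> where "loop_inv \<mu> Q \<nu>" "bep G \<nu> Q = {}"
    "prg_plus G \<mu> = (\<lambda>v. if v \<in> Q then Top else \<nu> v)"
proof -
  define Q where "Q i = fst (prg_plus_seq G \<mu> i)" for i
  define \<nu> where "\<nu> i = snd (prg_plus_seq G \<mu> i)" for i
  have seq: "prg_plus_seq G \<mu> i = (Q i, \<nu> i)" for i by (simp add: Q_def \<nu>_def)
  have init: "Q 0 = den_plus G \<mu>" "\<nu> 0 = \<mu>" by (simp_all add: Q_def \<nu>_def prg_plus_seq_def)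
  have step: "Q (Suc i) = Q i - bep G (\<nu> i) (Q i)"
    "\<nu> (Suc i) = lift G (\<nu> i) (bep G (\<nu> i) (Q i)) (positions G - Q i)" for i
  proof -
    have "prg_plus_seq G \<mu> (Suc i) = prg_plus_step G (prg_plus_seq G \<mu> i)"
      by (simp add: prg_plus_seq_def)
    then show "Q (Suc i) = Q i - bep G (\<nu> i) (Q i)"
      "\<nu> (Suc i) = lift G (\<nu> i) (bep G (\<nu> i) (Q i)) (positions G - Q i)"
      unfolding seq by (simp_all add: prg_plus_step_def Let_def)
  qed
  have fin: "finite (Q i)" for i
  proof (induction i)
    case 0
    show ?case using finite_positions by (simp add: init den_plus_def)
  qed (simp add: step)
  \<comment> \<open>Rounds with a nonempty batch shrink \<open>Q\<close>, so the cardinality clause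
    bounds their number; hence the \<open>LEAST\<close> in \<open>prg_plus\<close> refers to an
    actual stopping index.\<close>
  have inv: "loop_inv \<mu> (Q k) (\<nu> k) \<and> card (Q k) + k \<le> card (Q 0)"
    if "\<forall>i<k. bep G (\<nu> i) (Q i) \<noteq> {}" for k
    using that
  proof (induction k)
    case 0
    show ?case using loop_inv_init[OF sound] by (simp add: init)
  next
    case (Suc k)
    then have IH: "loop_inv \<mu> (Q k) (\<nu> k)" "card (Q k) + k \<le> card (Q 0)" by auto
    have ne: "bep G (\<nu> k) (Q k) \<noteq> {}" using Suc.prems by simp
    moreover have "bep G (\<nu> k) (Q k) \<subseteq> Q k" by (auto simp: bep_def is_arg_min_def)
    ultimately have "Q (Suc k) \<subset> Q k" by (auto simp: step)
    then have "card (Q (Suc k)) < card (Q k)" using fin by (rule psubset_card_mono[rotated])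
    then show ?case using IH(2) loop_inv_step[OF sound IH(1) ne] by (simp add: step)
  qed
  have ex: "\<exists>k. bep G (\<nu> k) (Q k) = {}"
  proof (rule ccontr)
    assume "\<not> ?thesis"
    then show False using inv[of "Suc (card (Q 0))"] by simp
  qed
  define k where "k = (LEAST k. bep G (\<nu> k) (Q k) = {})"
  have k: "bep G (\<nu> k) (Q k) = {}" unfolding k_def by (rule LeastI_ex[OF ex])
  moreover have "\<forall>i<k. bep G (\<nu> i) (Q i) \<noteq> {}" using not_less_Least unfolding k_def by blast
  then have "loop_inv \<mu> (Q k) (\<nu> k)" using inv by blast
  moreover have "prg_plus G \<mu> = (\<lambda>v. if v \<in> Q k then Top else \<nu> k v)"
    by (simp add: prg_plus_def seq k_def[symmetric])
  ultimately show ?thesis using that by blast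
qed

text \<open>An escape position and its exits have finite measures, so its forfeit is below
  \<open>Top\<close>. The minimum over the finite set \<open>Q\<close> is then also below
  \<open>Top\<close>, and a position attaining it belongs to \<open>bep\<close>.\<close>

lemma bep_empty_no_escape:
  assumes sound: "sound \<mu>" and inv: "loop_inv \<mu> Q \<nu>" and "bep G \<nu> Q = {}"
  shows "esc G \<nu> Q = {}"
proof (rule ccontr)
  assume "\<not> ?thesis"
  then obtain x where x: "x \<in> esc G \<nu> Q" by blast
  note facts = esc_facts[OF sound inv x]
  have Mv: "Mv G x \<inter> (positions G - Q) = Mv G x - Q" using Mv_subset by auto
  \<comment> \<open>The singleton lift serves only to name an exit that attains the forfeit of
    \<open>x\<close>.\<close>
  obtain u where u: "u \<in> Mv G x - Q"
    "lift G \<nu> {x} (positions G - Q) x = stretch G (\<nu> u) x"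
    using lift_attained[of x "{x}" "positions G - Q" \<nu>] facts(3,5) unfolding Mv by blast
  have u': "u \<in> positions G" "u \<notin> Q" using u(1) Mv_subset by auto
  obtain \<theta> where \<theta>: "\<nu> u = Value \<theta>" by (rule outside_value[OF sound inv u'])
  obtain \<eta> where \<eta>: "\<nu> x = Value \<eta>" using facts(4,6) by (cases "\<mu> x") auto
  have "bef G \<nu> Q x = difference (stretch G (\<nu> u) x) (\<nu> x)"
    using bef_eq_lift[OF x, of "{x}"] u(2) facts(4-6) by simp
  then have "bef G \<nu> Q x < Top" by (simp add: \<theta> \<eta>)
  moreover have "finite Q"
    using loop_invD(1)[OF inv] den_plus_eq[OF sound] finite_positions
    by (auto intro: finite_subset)
  then obtain m where m: "is_arg_min (bef G \<nu> Q) (\<lambda>w. w \<in> Q) m"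
    using ex_is_arg_min_if_finite[of Q "bef G \<nu> Q"] facts(1) by blast
  moreover have "bef G \<nu> Q m \<le> bef G \<nu> Q x"
    using m facts(1) by (auto simp: is_arg_min_def not_less)
  ultimately have "m \<in> bep G \<nu> Q" by (auto simp: bep_def)
  then show False using assms(3) by blast
qed

lemma prg_plus_inflationary:
  assumes sound: "sound \<mu>"
  shows "\<mu> v \<le> prg_plus G \<mu> v"
proof -
  obtain Q \<nu> where "loop_inv \<mu> Q \<nu>" "prg_plus G \<mu> = (\<lambda>v. if v \<in> Q then Top else \<nu> v)"
    using prg_plus_loop[OF sound] by metis
  then show ?thesis using loop_ge[OF sound] by simp
qed

text \<open>The bound is independent of \<open>\<mu>\<close>: values leaving the loop are rebuilt
  from zero positions by successive stretches. This confines the whole iteration to a finite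
  set.\<close>

lemma prg_plus_bounded:
  assumes sound: "sound \<mu>"
  shows "v \<in> positions G \<Longrightarrow> prg_plus G \<mu> v \<in> entries_le G (card (positions G))"
    and "v \<notin> positions G \<Longrightarrow> prg_plus G \<mu> v = \<mu> v"
proof -
  obtain Q \<nu> where inv: "loop_inv \<mu> Q \<nu>" and eq: "prg_plus G \<mu> = (\<lambda>v. if v \<in> Q then Top else \<nu> v)"
    using prg_plus_loop[OF sound] by metis
  have Q: "Q \<subseteq> positions G" using loop_invD(1)[OF inv] by (auto simp: den_plus_def)
  have "card (positions G - Q) \<le> card (positions G)"
    using finite_positions by (intro card_mono) auto
  then show "prg_plus G \<mu> v \<in> entries_le G (card (positions G))" if "v \<in> positions G"
    using loop_invD(5)[OF inv, of v] that entries_le_Top subsetD[OF entries_le_mono] by (auto simp: eq)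
  show "prg_plus G \<mu> v = \<mu> v" if "v \<notin> positions G"
    using loop_invD(2)[OF inv, of v] that Q by (auto simp: eq den_plus_def)
qed

text \<open>Turns measures into a potential with values in the group. The value at
  \<open>Top\<close> is a mere default: potentials are evaluated only along plays of finite
  measure.\<close>

definition finite_part :: "prog_measure \<Rightarrow> altlex" where
  "finite_part x = (case x of Value \<eta> \<Rightarrow> \<eta> | Top \<Rightarrow> 0)"

lemma finite_part_Value [simp]: "finite_part (Value \<eta>) = \<eta>"
  by (simp add: finite_part_def)

text \<open>With no escape left, player 0 can stay in \<open>Q\<close> along regress moves and
  player 1 cannot leave. On plays in \<open>Q\<close> that avoid old \<open>Top\<close> positions,
  measures are positive, hence unclipped, and form a potential for player 0; all other plays in
  \<open>Q\<close> fall into the old dominion.\<close>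

lemma sound_prg_plus:
  assumes sound: "sound \<mu>"
  shows "sound (prg_plus G \<mu>)"
proof -
  obtain Q \<nu> where inv: "loop_inv \<mu> Q \<nu>" and bep: "bep G \<nu> Q = {}"
    and eq: "prg_plus G \<mu> = (\<lambda>v. if v \<in> Q then Top else \<nu> v)"
    using prg_plus_loop[OF sound] by metis
  have no_esc: "esc G \<nu> Q = {}" by (rule bep_empty_no_escape[OF sound inv bep])
  have Q: "Q \<subseteq> den_plus G \<mu>" "Q \<subseteq> positions G"
    using loop_invD(1)[OF inv] by (auto simp: den_plus_def)
  have \<nu>_in: "\<nu> v = \<mu> v" if "v \<in> Q" for v using loop_invD(2)[OF inv, of v] that by blast
  have \<nu>_bot: "\<nu> v = Value 0" if "v \<in> positions G" "v \<notin> den_plus G \<mu>" for v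
    using loop_invD(2)[OF inv, of v] that by (auto simp: den_plus_eq[OF sound])
  have stay0: "\<exists>u\<in>Mv G v \<inter> Q. \<mu> v \<le> stretch G (\<mu> u) v" if "v \<in> Q" "v \<in> pos0 G" for v
  proof -
    have "v \<notin> esc G \<nu> Q" using no_esc by simp
    then have "\<exists>u\<in>Mv G v \<inter> Q. \<nu> v \<le> stretch G (\<nu> u) v"
      using that by (auto simp: esc_def not_less)
    then show ?thesis using \<nu>_in that(1) by auto
  qed
  have stay1: "Mv G v \<subseteq> Q" if "v \<in> Q" "v \<in> pos1 G" for v
    using no_esc that by (auto simp: esc_def)
  let ?\<rho> = "prg_plus G \<mu>"
  have \<rho>_in: "?\<rho> v = Top" if "v \<in> Q" for v using that by (simp add: eq)
  have \<rho>_out: "?\<rho> v = \<nu> v" if "v \<notin> Q" for v using that by (simp add: eq)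
  have adm: "admissible G v (?\<rho> v)" if "v \<in> positions G" for v
    using loop_invD(4)[OF inv, of v] that admissible_Top by (auto simp: eq)
  have reg0: "\<exists>u\<in>Mv G v. ?\<rho> v \<le> stretch G (?\<rho> u) v" if v: "v \<in> pos0 G" for v
  proof -
    have vp: "v \<in> positions G" using v by (simp add: positions_def)
    consider "v \<in> Q" | "v \<notin> den_plus G \<mu>" | "v \<in> den_plus G \<mu> - Q" by blast
    then show ?thesis
    proof cases
      case 1
      then obtain u where "u \<in> Mv G v" "u \<in> Q" using stay0[OF 1 v] by blast
      then show ?thesis using \<rho>_in[of u] by (intro bexI[of _ u]) simp_all
    next
      case 2
      then have "?\<rho> v = Value 0" using \<nu>_bot[OF vp] \<rho>_out[of v] Q by auto
      then show ?thesis using Mv_nonempty[OF vp] by (simp add: zero_le_stretch ex_in_conv)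
    next
      case 3
      then obtain u where "u \<in> Mv G v" "u \<notin> Q" "\<nu> v = stretch G (\<nu> u) v"
        using loop_invD(6)[OF inv 3] by blast
      then show ?thesis using 3 \<rho>_out[of u] \<rho>_out[of v] by (intro bexI[of _ u]) simp_all
    qed
  qed
  have reg1: "?\<rho> v \<le> stretch G (?\<rho> u) v" if v: "v \<in> pos1 G" "u \<in> Mv G v" for u v
  proof (cases "u \<in> Q")
    case True
    then show ?thesis using \<rho>_in by simp
  next
    case False
    then have vQ: "v \<notin> Q" using stay1[of v] v by blast
    show ?thesis
    proof (cases "v \<in> den_plus G \<mu>")
      case True
      then show ?thesis
        using loop_invD(8)[OF inv _ v(1), of u] v(2) False vQ \<rho>_out by simp
    next
      case bot: False
      have "?\<rho> v = Value 0" using \<nu>_bot[OF _ bot] \<rho>_out[OF vQ] v(1) by (auto simp: positions_def)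
      then show ?thesis by (simp add: zero_le_stretch)
    qed
  qed
  have "dominion Player0 {v \<in> positions G. ?\<rho> v = Top}"
  proof -
    let ?D = "{v \<in> positions G. \<mu> v = Top}"
    \<comment> \<open>Measures outside \<open>Q\<close> are finite, so the new \<open>Top\<close>
      region is exactly \<open>Q\<close>.\<close>
    have "?\<rho> v \<noteq> Top" if v: "v \<in> positions G" "v \<notin> Q" for v
      by (rule outside_value[OF sound inv v]) (simp add: \<rho>_out v)
    then have D': "{v \<in> positions G. ?\<rho> v = Top} = Q" using Q \<rho>_in by auto
    have "?\<rho> v = Top" if "\<mu> v = Top" for v
      using prg_plus_inflationary[OF sound, of v] that less_eq_top_is_Top by metis
    then have sub: "?D \<subseteq> Q" unfolding D'[symmetric] by auto
    define \<tau> where "\<tau> v = (SOME u. u \<in> Mv G v \<inter> Q \<and> \<mu> v \<le> stretch G (\<mu> u) v)" for v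
    have \<tau>: "\<tau> v \<in> Mv G v \<inter> Q \<and> \<mu> v \<le> stretch G (\<mu> (\<tau> v)) v" if "v \<in> Q" "v \<in> pos0 G" for v
    proof -
      have "\<exists>u. u \<in> Mv G v \<inter> Q \<and> \<mu> v \<le> stretch G (\<mu> u) v" using stay0[OF that] by auto
      then show ?thesis unfolding \<tau>_def by (rule someI_ex)
    qed
    have "traps Player0 \<tau> (Q - ?D) Q"
      unfolding traps_def owned.simps
    proof
      fix v assume "v \<in> Q - ?D"
      then show "(v \<in> pos0 G \<longrightarrow> \<tau> v \<in> Mv G v \<inter> Q) \<and> (v \<notin> pos0 G \<longrightarrow> Mv G v \<subseteq> Q)"
        using \<tau>[of v] stay1[of v] Q(2) by (auto simp: positions_def)
    qed
    moreover have "wins_within Player0 \<tau> (Q - ?D)"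
      unfolding wins_within_def
    proof (intro allI impI, elim conjE)
      fix \<pi> assume \<pi>: "is_play G \<pi>" "range \<pi> \<subseteq> Q - ?D" "follows Player0 \<tau> \<pi>"
      show "wins G Player0 \<pi>"
      proof (rule wins_Player0[OF \<pi>(1), of "\<lambda>v. finite_part (\<mu> v)"])
        fix n
        let ?v = "\<pi> n" and ?u = "\<pi> (Suc n)"
        have v: "?v \<in> Q" "?v \<notin> ?D" and u: "?u \<in> Q" "?u \<notin> ?D" using \<pi>(2) by auto
        have mv: "?u \<in> Mv G ?v" using \<pi>(1) by (simp add: is_play_def)
        have le: "\<mu> ?v \<le> stretch G (\<mu> ?u) ?v"
        proof (cases "?v \<in> pos0 G")
          case True
          then have "?u = \<tau> ?v" using \<pi>(3) by (simp add: follows_def)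
          then show ?thesis using \<tau>[OF v(1) True] by simp
        next
          case False
          then have "?v \<in> pos1 G" using v(1) Q(2) by (auto simp: positions_def)
          then show ?thesis using sound mv by (simp add: sound_def regress_def)
        qed
        obtain \<eta> where \<eta>: "\<mu> ?v = Value \<eta>" using v Q(2) by (cases "\<mu> ?v") auto
        obtain \<theta> where \<theta>: "\<mu> ?u = Value \<theta>" using u Q(2) by (cases "\<mu> ?u") auto
        have "?v \<in> den_plus G \<mu>" using v(1) Q(1) by blast
        then have "\<eta> \<le> \<theta> + delta (pr G ?v)" by (rule regress_linear[OF sound _ \<eta> \<theta> le])
        then show "finite_part (\<mu> ?v) \<le> delta (pr G ?v) + finite_part (\<mu> ?u)"
          by (simp add: \<eta> \<theta> add.commute)
      qed
    qed
    moreover have "dominion Player0 ?D" using sound by (simp add: sound_def)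
    ultimately show ?thesis
      unfolding D' using dominion_extend[OF _ sub Q(2)] by blast
  qed
  then show ?thesis using adm reg0 reg1 by (simp add: sound_def regress_def)
qed

section \<open>Fixpoints\<close>

text \<open>At a fixpoint \<open>\<nu>\<close> agrees with \<open>\<mu>\<close> outside
  \<open>Q\<close>, so the loop invariant for departed positions speaks about \<open>\<mu>\<close>
  itself. Bottom positions are covered by the fixpoint equation of \<open>prg_bot\<close>.\<close>

lemma fixpoint_progress:
  assumes sound: "sound \<mu>" and bot: "prg_bot G \<mu> = \<mu>" and plus: "prg_plus G \<mu> = \<mu>"
    and v: "v \<in> positions G" "\<mu> v \<noteq> Top"
  shows "v \<in> pos0 G \<Longrightarrow> u \<in> Mv G v \<Longrightarrow> stretch G (\<mu> u) v \<le> \<mu> v"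
    and "v \<in> pos1 G \<Longrightarrow> \<exists>u\<in>Mv G v. stretch G (\<mu> u) v \<le> \<mu> v"
proof -
  obtain Q \<nu> where inv: "loop_inv \<mu> Q \<nu>" and eq: "prg_plus G \<mu> = (\<lambda>v. if v \<in> Q then Top else \<nu> v)"
    using prg_plus_loop[OF sound] by metis
  have \<nu>: "\<nu> u = \<mu> u" if "u \<notin> Q" for u using fun_cong[OF eq, of u] that by (simp add: plus)
  have vQ: "v \<notin> Q" using fun_cong[OF eq, of v] v(2) by (auto simp: plus)
  have lift: "\<mu> v = lift G \<mu> (den_bot G \<mu>) (positions G) v"
    using bot by (simp add: prg_bot_def)
  have v_cases: "v \<in> den_bot G \<mu> \<or> v \<in> den_plus G \<mu> - Q"
    using v(1) vQ by (auto simp: den_plus_def)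
  show "stretch G (\<mu> u) v \<le> \<mu> v" if "v \<in> pos0 G" "u \<in> Mv G v"
    using v_cases
  proof
    assume "v \<in> den_bot G \<mu>"
    then show ?thesis
      using lift_ge_pos0[of v "den_bot G \<mu>" u "positions G" \<mu>] that Mv_subset lift by auto
  next
    assume "v \<in> den_plus G \<mu> - Q"
    then show ?thesis
      using loop_invD(7)[OF inv _ that] \<nu>[of u] \<nu>[OF vQ] by auto
  qed
  show "\<exists>u\<in>Mv G v. stretch G (\<mu> u) v \<le> \<mu> v"
    using v_cases
  proof
    assume "v \<in> den_bot G \<mu>"
    moreover have "Mv G v \<inter> positions G \<noteq> {}" using Mv_nonempty[OF v(1)] Mv_subset by blast
    ultimately obtain u where "u \<in> Mv G v" "\<mu> v = stretch G (\<mu> u) v"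
      using lift_attained[of v "den_bot G \<mu>" "positions G" \<mu>] v(1) lift by (metis IntE)
    then show ?thesis by (metis order_refl)
  next
    assume "v \<in> den_plus G \<mu> - Q"
    then obtain u where "u \<in> Mv G v" "u \<notin> Q" "\<nu> v = stretch G (\<nu> u) v"
      using loop_invD(6)[OF inv] by blast
    then show ?thesis using \<nu>[of u] \<nu>[OF vQ] by (metis order_refl)
  qed
qed

text \<open>A progress move never leads from a finite measure to \<open>Top\<close>, so player 1 can
  keep the play inside. Clipping only increases a stretch, so the progress inequality is also
  linear, and the measures form a potential for player 1.\<close>

lemma fixpoint_dominion:
  assumes "sound \<mu>" "prg_bot G \<mu> = \<mu>" "prg_plus G \<mu> = \<mu>"
  shows "dominion Player1 {v \<in> positions G. \<mu> v \<noteq> Top}" (is "dominion _ ?D")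
proof -
  note prog = fixpoint_progress[OF assms]
  define \<tau> where "\<tau> v = (SOME u. u \<in> Mv G v \<and> stretch G (\<mu> u) v \<le> \<mu> v)" for v
  have \<tau>: "\<tau> v \<in> Mv G v \<and> stretch G (\<mu> (\<tau> v)) v \<le> \<mu> v" if "v \<in> ?D" "v \<in> pos1 G" for v
  proof -
    have "\<exists>u. u \<in> Mv G v \<and> stretch G (\<mu> u) v \<le> \<mu> v" using prog(2)[of v] that by auto
    then show ?thesis unfolding \<tau>_def by (rule someI_ex)
  qed
  have below: "u \<in> ?D" if "v \<in> ?D" "u \<in> Mv G v" "stretch G (\<mu> u) v \<le> \<mu> v" for u v
    using that Mv_subset less_eq_top_is_Top[of "\<mu> v"] by (cases "\<mu> u") auto
  have "traps Player1 \<tau> ?D ?D"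
    unfolding traps_def owned.simps
  proof
    fix v assume v: "v \<in> ?D"
    have "Mv G v \<subseteq> ?D" if "v \<notin> pos1 G"
      using v that below[OF v] prog(1)[of v] by (auto simp: positions_def)
    then show "(v \<in> pos1 G \<longrightarrow> \<tau> v \<in> Mv G v \<inter> ?D) \<and> (v \<notin> pos1 G \<longrightarrow> Mv G v \<subseteq> ?D)"
      using \<tau>[OF v] below[OF v] by blast
  qed
  moreover have "wins_within Player1 \<tau> ?D"
    unfolding wins_within_def
  proof (intro allI impI, elim conjE)
    fix \<pi> assume \<pi>: "is_play G \<pi>" "range \<pi> \<subseteq> ?D" "follows Player1 \<tau> \<pi>"
    show "wins G Player1 \<pi>"
    proof (rule wins_Player1[OF \<pi>(1), of "\<lambda>v. finite_part (\<mu> v)"])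
      fix n
      let ?v = "\<pi> n" and ?u = "\<pi> (Suc n)"
      have v: "?v \<in> ?D" and u: "?u \<in> ?D" using \<pi>(2) by blast+
      have mv: "?u \<in> Mv G ?v" using \<pi>(1) by (simp add: is_play_def)
      have le: "stretch G (\<mu> ?u) ?v \<le> \<mu> ?v"
      proof (cases "?v \<in> pos1 G")
        case True
        then have "?u = \<tau> ?v" using \<pi>(3) by (simp add: follows_def)
        then show ?thesis using \<tau>[OF v True] by simp
      next
        case False
        then show ?thesis using prog(1)[of ?v ?u] v mv by (auto simp: positions_def)
      qed
      obtain \<eta> where \<eta>: "\<mu> ?v = Value \<eta>" using v by (cases "\<mu> ?v") auto
      obtain \<theta> where \<theta>: "\<mu> ?u = Value \<theta>" using u by (cases "\<mu> ?u") auto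
      show "delta (pr G ?v) + finite_part (\<mu> ?u) \<le> finite_part (\<mu> ?v)"
        using le by (simp add: \<eta> \<theta> add.commute)
    qed
  qed
  ultimately show ?thesis unfolding dominion_def by blast
qed

text \<open>The iterates ascend within a finite set of measure functions, so two of them coincide
  and the sequence is constant from the earlier one on.\<close>

lemma sol_fixpoint:
  shows "sound (sol G mf_bot)"
    and "prg_bot G (sol G mf_bot) = sol G mf_bot"
    and "prg_plus G (sol G mf_bot) = sol G mf_bot"
proof -
  define F where "F = prg_plus G \<circ> prg_bot G"
  define x where "x n = (F ^^ n) mf_bot" for n
  have x_Suc: "x (Suc n) = F (x n)" for n by (simp add: x_def)
  have sound: "sound (x n)" for n
    by (induction n)
      (simp_all add: x_def F_def sound_mf_bot sound_prg_bot sound_prg_plus)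
  have up1: "x n \<le> prg_bot G (x n)" for n
    using prg_bot_inflationary[OF sound] by (simp add: le_fun_def)
  have up2: "prg_bot G (x n) \<le> x (Suc n)" for n
    using prg_plus_inflationary[OF sound_prg_bot[OF sound]] by (simp add: le_fun_def x_Suc F_def)
  have "x n \<le> x (Suc n)" for n using up1 up2 by (rule order_trans)
  then have mono: "m \<le> n \<Longrightarrow> x m \<le> x n" for m n by (rule lift_Suc_mono_le)
  let ?S = "{\<mu> :: 'v measure_fun. \<forall>v. (v \<in> positions G \<longrightarrow> \<mu> v \<in> entries_le G (card (positions G))) \<and>
    (v \<notin> positions G \<longrightarrow> \<mu> v = Value 0)}"
  have "x n \<in> ?S" for n
  proof (induction n)
    case 0
    show ?case by (simp add: x_def mf_bot_def entries_le_zero)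
  next
    case (Suc n)
    have "prg_bot G (x n) v = x n v" if "v \<notin> positions G" for v
      using that by (simp add: prg_bot_def lift_other)
    then show ?case
      using Suc prg_plus_bounded[OF sound_prg_bot[OF sound]] by (simp add: x_Suc F_def)
  qed
  moreover have "finite ?S"
    using finite_positions finite_entries_le[OF finite_prios] by (rule finite_set_of_finite_funs)
  ultimately have "finite (range x)"
    by (intro finite_subset[of "range x" ?S]) auto
  then have "\<not> inj x" using finite_imageD by blast
  then obtain i j where ij: "x i = x j" "i < j"
    unfolding inj_def by (metis linorder_neqE_nat)
  have "x (Suc i) \<le> x i" using mono[of "Suc i" j] ij by simp
  \<comment> \<open>\<open>prg_bot G (x i)\<close> lies between \<open>x i\<close> and
    \<open>x (Suc i)\<close>, so \<open>prg_bot\<close> fixes \<open>x i\<close> on its own, not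
    only in composition with \<open>prg_plus\<close>.\<close>
  then have stable: "x (Suc i) = x i" and fix_bot: "prg_bot G (x i) = x i"
    using up1[of i] up2[of i] by (simp_all add: order.antisym order.trans[OF up1 up2])
  have const: "x n = x i" if "n \<ge> i" for n
    using that by (induction n rule: dec_induct) (use stable in \<open>simp_all add: x_Suc\<close>)
  have "sol G mf_bot = x i"
    unfolding sol_def F_def[symmetric] x_def[symmetric]
  proof (rule the_equality)
    show "\<exists>N. \<forall>n\<ge>N. x n = x i" using const by blast
    fix \<mu> assume "\<exists>N. \<forall>n\<ge>N. x n = \<mu>"
    then obtain N where N: "\<forall>n\<ge>N. x n = \<mu>" by blast
    \<comment> \<open>Two eventual values are compared at an index past both thresholds, which makes
      the limit unique.\<close>
    have "x (max N i) = \<mu>" using N by simp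
    moreover have "x (max N i) = x i" by (rule const) simp
    ultimately show "\<mu> = x i" by simp
  qed
  moreover have "prg_plus G (x i) = x i"
    using stable fix_bot by (simp add: x_Suc F_def)
  ultimately show "sound (sol G mf_bot)"
    "prg_bot G (sol G mf_bot) = sol G mf_bot" "prg_plus G (sol G mf_bot) = sol G mf_bot"
    using sound[of i] fix_bot by simp_all
qed

end

theorem theorem27:
  fixes G :: "'v game"
  assumes "parity_game G"
  shows "winning_region G Player0 = {v \<in> positions G. trunc G (sol G mf_bot v) v = Top} \<and>
         winning_region G Player1 = {v \<in> positions G. trunc G (sol G mf_bot v) v \<noteq> Top}"
proof -
  interpret finite_parity_game G by unfold_locales (rule assms)
  let ?\<mu> = "sol G mf_bot"
  let ?D0 = "{v \<in> positions G. ?\<mu> v = Top}" and ?D1 = "{v \<in> positions G. ?\<mu> v \<noteq> Top}"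
  have "?D0 \<subseteq> winning_region G Player0"
    using sol_fixpoint(1) by (intro dominion_winning_region) (simp add: sound_def)
  moreover have "?D1 \<subseteq> winning_region G Player1"
    by (intro dominion_winning_region fixpoint_dominion sol_fixpoint)
  moreover have "winning_region G Player0 \<union> winning_region G Player1 \<subseteq> positions G"
    by (auto simp: winning_region_def)
  \<comment> \<open>\<open>?D0\<close> and \<open>?D1\<close> cover all positions and lie in
    disjoint winning regions, so both inclusions are equalities.\<close>
  ultimately have "winning_region G Player0 = ?D0 \<and> winning_region G Player1 = ?D1"
    using winning_regions_disjoint by blast
  moreover have "trunc G x v = Top \<longleftrightarrow> x = Top" for x v by (cases x) auto
  ultimately show ?thesis by simp
qed

end
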